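(* Let $p$ be a prime and let $\mathcal{F}$ be a saturated fusion system on a finite $p$-group $P$. If $X$ is a normal subgroup of $P$, then $\mathcal{F}=PC_{\mathcal{F}}(X)$ if and only if $X\le Z_\infty(\mathcal{F})$.
   Context: Fusion systems and saturated fusion systems on finite $p$-groups are as usual: $\mathcal F$ is a category whose objects are the subgroups of $P$ and whose morphisms are injective homomorphisms, including all conjugations $c_g$ by elements $g\in P$. Maps are written on the right. For a subgroup $Q\le P$, $N_P(Q)C_{\mathcal{F}}(Q)$ is the subsystem of $\mathcal{F}$ on $N_P(Q)$ consisting of all morphisms $\phi:R\to S$ in $\mathcal{F}$ (with $R,S\le N_P(Q)$) that extend to a morphism $\bar\phi:QR\to QS$ in $\mathcal{F}$ with $\bar\phi|_Q=c_g$ for some $g\in N_P(Q)$. When $Q$ is normal in $P$ this is written $PC_{\mathcal{F}}(Q)$. A subgroup $T\le P$ is strongly $\mathcal{F}$-closed if $Q\phi\le T$ for every $Q\le T$ and every morphism $\phi:Q\to P$ in $\mathcal{F}$. For such $T$, $\mathcal{F}/T$ is the fusion system on $P/T$ whose morphisms $Q/T\to R/T$ (for $T\le Q,R\le P$) are those induced by morphisms $Q\to R$ in $\mathcal{F}$. The centre $Z(\mathcal{F})$ is the set of all $x\in P$ such that every morphism $\phi:Q\to R$ in $\mathcal{F}$ has an extension $\bar\phi:Q\langle x\rangle\to R\langle x\rangle$ in $\mathcal{F}$ with $x\bar\phi=x$. Put $Z_1(\mathcal{F})=Z(\mathcal{F})$ and let $Z_i(\mathcal{F})$ be the preimage in $P$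 of $Z(\mathcal{F}/Z_{i-1}(\mathcal{F}))$. The largest term of this ascending series is the hypercentre $Z_\infty(\mathcal{F})$. *)

theory Defs
  imports "HOL-Algebra.Algebra" "HOL-Computational_Algebra.Primes"
begin

text \<open>
  A category whose objects are the subgroups of a group \<open>P\<close> is given by its morphism sets:
  \<open>F Q R\<close> is the set of morphisms from \<open>Q\<close> to \<open>R\<close>. Morphisms are extensional functions, so that
  equality of functions is equality of morphisms, and \<open>F Q R\<close> is empty if \<open>Q\<close> or \<open>R\<close> is not an
  object, so that two fusion systems on \<open>P\<close> are equal iff they are equal as functions.
\<close>

type_synonym 'a hom_sets = "'a set \<Rightarrow> 'a set \<Rightarrow> ('a \<Rightarrow> 'a) set"

text \<open>Conjugation by \<open>g\<close> as a right action, restricted to \<open>Q\<close>.\<close>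

definition conj_map :: "('a, 'b) monoid_scheme \<Rightarrow> 'a \<Rightarrow> 'a set \<Rightarrow> 'a \<Rightarrow> 'a" where
  "conj_map P g Q = (\<lambda>x\<in>Q. inv\<^bsub>P\<^esub> g \<otimes>\<^bsub>P\<^esub> x \<otimes>\<^bsub>P\<^esub> g)"

definition centralizer :: "('a, 'b) monoid_scheme \<Rightarrow> 'a set \<Rightarrow> 'a set" where
  "centralizer P Q = {g \<in> carrier P. \<forall>u\<in>Q. g \<otimes>\<^bsub>P\<^esub> u = u \<otimes>\<^bsub>P\<^esub> g}"

text \<open>Inclusions are the maps \<open>conj_map P \<one> Q\<close>, so closure under restriction and under enlarging
  the codomain follows from \<open>conj\<close> and \<open>comp\<close>.\<close>

locale fusion_system = group P for P :: "('a, 'b) monoid_scheme" (structure) +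
  fixes F :: "'a hom_sets"
  assumes objects: "\<phi> \<in> F Q R \<Longrightarrow> subgroup Q P \<and> subgroup R P"
    and morphism: "\<phi> \<in> F Q R \<Longrightarrow>
      \<phi> \<in> extensional Q \<and> \<phi> \<in> mon (P\<lparr>carrier := Q\<rparr>) (P\<lparr>carrier := R\<rparr>)"
    and conj: "\<lbrakk>subgroup Q P; subgroup R P; g \<in> carrier P; conj_map P g Q ` Q \<subseteq> R\<rbrakk>
      \<Longrightarrow> conj_map P g Q \<in> F Q R"
    and comp: "\<lbrakk>\<phi> \<in> F Q R; \<psi> \<in> F R S\<rbrakk> \<Longrightarrow> compose Q \<psi> \<phi> \<in> F Q S"
    and image: "\<phi> \<in> F Q R \<Longrightarrow> \<phi> \<in> F Q (\<phi> ` Q)"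
    and inverse: "\<lbrakk>\<phi> \<in> F Q R; \<phi> ` Q = R\<rbrakk> \<Longrightarrow> restrict (inv_into Q \<phi>) R \<in> F R Q"

definition F_conjugate :: "'a hom_sets \<Rightarrow> 'a set \<Rightarrow> 'a set \<Rightarrow> bool" where
  "F_conjugate F Q R \<longleftrightarrow> (\<exists>\<phi>\<in>F Q R. \<phi> ` Q = R)"

definition fully_normalized ::
  "('a, 'b) monoid_scheme \<Rightarrow> 'a hom_sets \<Rightarrow> 'a set \<Rightarrow> bool" where
  "fully_normalized P F Q \<longleftrightarrow>
     (\<forall>R. F_conjugate F Q R \<longrightarrow> card (normalizer P R) \<le> card (normalizer P Q))"

definition fully_centralized ::
  "('a, 'b) monoid_scheme \<Rightarrow> 'a hom_sets \<Rightarrow> 'a set \<Rightarrow> bool" where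
  "fully_centralized P F Q \<longleftrightarrow>
     (\<forall>R. F_conjugate F Q R \<longrightarrow> card (centralizer P R) \<le> card (centralizer P Q))"

definition Aut_F :: "'a hom_sets \<Rightarrow> 'a set \<Rightarrow> ('a \<Rightarrow> 'a) monoid" where
  "Aut_F F Q = (BijGroup Q)\<lparr>carrier := F Q Q\<rparr>"

definition Aut_P :: "('a, 'b) monoid_scheme \<Rightarrow> 'a set \<Rightarrow> ('a \<Rightarrow> 'a) set" where
  "Aut_P P Q = (\<lambda>g. conj_map P g Q) ` normalizer P Q"

definition sylow_subgroup :: "nat \<Rightarrow> 'a set \<Rightarrow> ('a, 'b) monoid_scheme \<Rightarrow> bool" where
  "sylow_subgroup p H G \<longleftrightarrow> subgroup H G \<and> card H = p ^ multiplicity p (order G)"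

text \<open>The group usually called \<open>N\<^sub>\<phi>\<close>, for \<open>\<phi>\<close> a morphism with domain \<open>Q\<close>.\<close>

definition extension_domain ::
  "('a, 'b) monoid_scheme \<Rightarrow> 'a set \<Rightarrow> ('a \<Rightarrow> 'a) \<Rightarrow> 'a set" where
  "extension_domain P Q \<phi> =
     {g \<in> normalizer P Q. \<exists>h\<in>normalizer P (\<phi> ` Q).
        \<forall>u\<in>Q. \<phi> (conj_map P g Q u) = conj_map P h (\<phi> ` Q) (\<phi> u)}"

text \<open>Saturation in the sense of Broto, Levi and Oliver.\<close>

locale saturated_fusion_system = fusion_system P F
  for p :: nat and P :: "('a, 'b) monoid_scheme" (structure) and F :: "'a hom_sets" +
  assumes prime_p: "Factorial_Ring.prime p"
    and finite_carrier: "finite (carrier P)"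
    and p_group: "\<exists>n. order P = p ^ n"
    and fully_normalized_imp: "\<lbrakk>subgroup Q P; fully_normalized P F Q\<rbrakk>
      \<Longrightarrow> fully_centralized P F Q \<and> sylow_subgroup p (Aut_P P Q) (Aut_F F Q)"
    and extension: "\<lbrakk>\<phi> \<in> F Q (carrier P); fully_centralized P F (\<phi> ` Q)\<rbrakk>
      \<Longrightarrow> \<exists>\<psi>\<in>F (extension_domain P Q \<phi>) (carrier P). \<forall>u\<in>Q. \<psi> u = \<phi> u"

text \<open>The subsystem \<open>N\<^sub>P(Q)C\<^sub>F(Q)\<close> on \<open>N\<^sub>P(Q)\<close>; for \<open>Q\<close> normal in \<open>P\<close> this is \<open>PC\<^sub>F(Q)\<close>.\<close>

definition NC_system ::
  "('a, 'b) monoid_scheme \<Rightarrow> 'a hom_sets \<Rightarrow> 'a set \<Rightarrow> 'a hom_sets" where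
  "NC_system P F Q R S =
     {\<phi> \<in> F R S. R \<subseteq> normalizer P Q \<and> S \<subseteq> normalizer P Q \<and>
        (\<exists>\<psi>\<in>F (Q <#>\<^bsub>P\<^esub> R) (Q <#>\<^bsub>P\<^esub> S). (\<forall>u\<in>R. \<psi> u = \<phi> u) \<and>
           (\<exists>g\<in>normalizer P Q. \<forall>u\<in>Q. \<psi> u = conj_map P g Q u))}"

definition centre :: "('a, 'b) monoid_scheme \<Rightarrow> 'a hom_sets \<Rightarrow> 'a set" where
  "centre P F =
     {x \<in> carrier P. \<forall>Q R. \<forall>\<phi>\<in>F Q R.
        \<exists>\<psi>\<in>F (generate P (insert x Q)) (generate P (insert x R)).
          (\<forall>u\<in>Q. \<psi> u = \<phi> u) \<and> \<psi> x = x}"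

text \<open>The system \<open>F/T\<close> on \<open>P Mod T\<close>, meaningful for \<open>T\<close> strongly \<open>F\<close>-closed (hence normal in \<open>P\<close>).
  An object \<open>Q/T\<close> is represented by its set of cosets.\<close>

definition quotient_object ::
  "('a, 'b) monoid_scheme \<Rightarrow> 'a set \<Rightarrow> 'a set \<Rightarrow> 'a set set" where
  "quotient_object P T Q = (\<lambda>x. T #>\<^bsub>P\<^esub> x) ` Q"

definition quotient_system ::
  "('a, 'b) monoid_scheme \<Rightarrow> 'a hom_sets \<Rightarrow> 'a set \<Rightarrow> 'a set hom_sets" where
  "quotient_system P F T Q' R' =
     {\<phi>' \<in> extensional Q'. \<exists>Q R. \<exists>\<phi>\<in>F Q R. T \<subseteq> Q \<and> T \<subseteq> R \<and>
        Q' = quotient_object P T Q \<and> R' = quotient_object P T R \<and>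
        (\<forall>x\<in>Q. \<phi>' (T #>\<^bsub>P\<^esub> x) = T #>\<^bsub>P\<^esub> \<phi> x)}"

text \<open>The indexing is shifted: \<open>centre_series P F i\<close> is \<open>Z\<^sub>i\<^sub>+\<^sub>1(F)\<close>, since the series starts at
  \<open>Z\<^sub>1(F) = Z(F)\<close>.\<close>

primrec centre_series :: "('a, 'b) monoid_scheme \<Rightarrow> 'a hom_sets \<Rightarrow> nat \<Rightarrow> 'a set" where
  "centre_series P F 0 = centre P F"
| "centre_series P F (Suc i) =
     {x \<in> carrier P. centre_series P F i #>\<^bsub>P\<^esub> x \<in>
        centre (P Mod centre_series P F i) (quotient_system P F (centre_series P F i))}"

definition hypercentre :: "('a, 'b) monoid_scheme \<Rightarrow> 'a hom_sets \<Rightarrow> 'a set" where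
  "hypercentre P F = (GREATEST Z. Z \<in> range (centre_series P F))"

end

theory Submission
  imports Defs
begin

text \<open>
  Call \<open>x\<close> central relative to a strongly closed subgroup \<open>T\<close> if every morphism between overgroups
  of \<open>T\<close> extends to \<open>x\<close>, up to changing values modulo \<open>T\<close>, so that \<open>x\<close> is fixed modulo \<open>T\<close>.
  These elements form the preimage of \<open>Z(F/T)\<close>, so the ascending series can be studied inside \<open>P\<close>:
  each \<open>Z\<^sub>i\<close> is strongly closed and every morphism acts trivially on its elements modulo
  \<open>Z\<^sub>i\<^sub>-\<^sub>1\<close>.

  If \<open>F = PC\<^sub>F(N)\<close> and \<open>N\<close> is not contained in the hypercentre \<open>Z\<close>, then the image of \<open>N\<close> in \<open>P/Z\<close>
  meets the centre of this \<open>p\<close>-group; a preimage in \<open>N\<close> of a nontrivial element of the intersection is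
  central relative to \<open>Z\<close>, a contradiction.

  For the converse it suffices to extend each morphism \<open>R \<rightarrow> S\<close> to \<open>ZR \<rightarrow> ZS\<close> and to show that it
  then acts on \<open>Z\<close> as an element of \<open>P\<close>. The automorphisms of \<open>T\<close> in \<open>F\<close> that are trivial modulo \<open>Z\<close>
  stabilise the chain of the subgroups \<open>T \<inter> Z\<^sub>i\<close>, hence form a normal \<open>p\<close>-subgroup, which for fully
  normalized \<open>T\<close> lies in the Sylow subgroup induced by \<open>P\<close>. For \<open>T = Z\<close> this is the second claim.
  It also shows that every isomorphism from \<open>R\<close> to a fully normalized subgroup extends to
  \<open>R N\<^sub>Z(R)\<close>, which is larger than \<open>R\<close> unless \<open>Z \<le> R\<close>, so downward induction on \<open>|R|\<close> extends it
  to \<open>ZR\<close>; an arbitrary morphism is a composite of such an isomorphism and the inverse of another.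
\<close>

section \<open>Finite groups\<close>

text \<open>By the second isomorphism theorem the product \<open>K <#> S\<close> is a subgroup whose
  order is again a power of \<open>p\<close>. It divides the group order, so it cannot exceed the
  order of \<open>S\<close>, and the product collapses to \<open>S\<close>.\<close>

lemma (in group) normal_p_subgroup_in_sylow:
  fixes p k :: nat
  assumes "Factorial_Ring.prime p" and fin: "finite (carrier G)"
    and K: "K \<lhd> G" "card K = p ^ k" and S: "sylow_subgroup p S G"
  shows "K \<subseteq> S"
proof -
  have sS: "subgroup S G" and cS: "card S = p ^ multiplicity p (order G)"
    using S by (auto simp: sylow_subgroup_def)
  interpret K: second_isomorphism_grp K G S
    using K sS by (simp add: second_isomorphism_grp_def second_isomorphism_grp_axioms_def)
  let ?H = "K <#> S"
  have H: "subgroup ?H G" by (rule K.normal_set_mult_subgroup)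
  have gS: "group (G\<lparr>carrier := S\<rparr>)" and gH: "group (G\<lparr>carrier := ?H\<rparr>)"
    using sS H subgroup_imp_group by auto
  have KS: "subgroup (K \<inter> S) (G\<lparr>carrier := S\<rparr>)"
    using K.normal_subgrp_intersection_normal normal_imp_subgroup by (metis inf_commute)
  have KH: "subgroup K (G\<lparr>carrier := ?H\<rparr>)"
    using normal_restrict_supergroup[OF H K(1) K.H_contained_in_set_mult] normal_imp_subgroup by blast
  have "card (rcosets\<^bsub>G\<lparr>carrier := S\<rparr>\<^esub> (K \<inter> S)) = card (rcosets\<^bsub>G\<lparr>carrier := ?H\<rparr>\<^esub> K)"
    using iso_same_order[OF K.normal_intersection_quotient_isom] by (simp add: order_def FactGroup_def)
  \<comment> \<open>\<open>c\<close> is at once the index of \<open>K \<inter> S\<close> in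
    \<open>S\<close> and of \<open>K\<close> in the product. The first makes it a power of
    \<open>p\<close>, the second gives the order of the product.\<close>
  then obtain c where c: "c * card (K \<inter> S) = card S" "c * card K = card ?H"
    using group.lagrange[OF gS KS] group.lagrange[OF gH KH] by (auto simp: order_def)
  obtain j where "c = p ^ j"
    using c(1) cS assms(1) by (metis divides_primepow_nat dvd_triv_left)
  then have H_pow: "card ?H = p ^ (j + k)" using c(2) K(2) by (simp add: power_add)
  have "card ?H dvd order G" using lagrange[OF H] by (metis dvd_triv_right)
  then have "j + k \<le> multiplicity p (order G)"
    using H_pow assms(1) fin order_gt_0_iff_finite
    by (intro multiplicity_geI) (auto simp: not_prime_unit)
  then have "card ?H \<le> card S" using H_pow cS assms(1)
    by (metis One_nat_def Suc_leI power_increasing prime_gt_0_nat)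
  then have "S = ?H"
    using K.S_contained_in_set_mult H fin by (meson card_seteq finite_subset subgroup.subset)
  then show ?thesis using K.H_contained_in_set_mult by simp
qed

text \<open>A prime \<open>q\<close> other than \<open>p\<close> dividing the order would give, by
  Cauchy's theorem (Sylow's with exponent 1), a nontrivial element killed by \<open>q\<close>. The
  hypothesis speaks of an arbitrary exponent prime to \<open>p\<close> because that is what coprime
  action handles.\<close>

lemma (in group) p_groupI:
  assumes p: "Factorial_Ring.prime p" and fin: "finite (carrier G)"
    and tors: "\<And>x m. \<lbrakk>x \<in> carrier G; coprime m p; x [^] m = \<one>\<rbrakk> \<Longrightarrow> x = \<one>"
  shows "\<exists>k::nat. order G = p ^ k"
proof -
  have "q = p" if q: "Factorial_Ring.prime q" "q dvd order G" for q
  proof (rule ccontr)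
    assume "q \<noteq> p"
    obtain m where "order G = q ^ 1 * m" using q(2) by (auto elim: dvdE)
    then obtain H where H: "subgroup H G" "card H = q ^ 1"
      using sylow_thm[OF q(1) is_group _ fin] by metis
    have "card H \<noteq> 1" using H(2) q(1) by auto
    then have "H \<noteq> {\<one>}" by auto
    then obtain x where x: "x \<in> H" "x \<noteq> \<one>"
      using subgroup.one_closed[OF H(1)] by blast
    have "x [^] q = \<one>"
      using group.pow_order_eq_1[OF subgroup_imp_group[OF H(1)], of x] x H
      by (simp add: order_def nat_pow_def)
    moreover have "coprime q p" using q(1) p \<open>q \<noteq> p\<close> by (simp add: primes_coprime)
    ultimately show False using tors x H(1) by (meson subgroup.mem_carrier)
  qed
  moreover have "order G \<noteq> 0" using fin order_gt_0_iff_finite by simp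
  then obtain k m where m: "order G = p ^ k * m" "\<not> p dvd m"
    using multiplicity_decompose'[of "order G" p] p by (metis not_prime_unit)
  ultimately have "m = 1"
    by (metis dvd_mult prime_factor_nat)
  then show ?thesis using m by auto
qed

text \<open>Class equation inside \<open>N\<close>: without a nontrivial central element, every
  conjugacy class in \<open>N - {\<one>}\<close> has length divisible by \<open>p\<close>, so
  \<open>p\<close> divides both |N| - 1 and |N|.\<close>

lemma (in group) normal_subgroup_meets_centre:
  fixes p n :: nat
  assumes p: "Factorial_Ring.prime p" and ord: "order G = p ^ n"
    and N: "N \<lhd> G" "N \<noteq> {\<one>}"
  shows "\<exists>x\<in>N. x \<noteq> \<one> \<and> (\<forall>g\<in>carrier G. g \<otimes> x = x \<otimes> g)"
proof (rule ccontr)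
  assume no: "\<not> ?thesis"
  let ?c = "\<lambda>g. \<lambda>h\<in>carrier G. g \<otimes> h \<otimes> inv g"
  interpret c: group_action G "carrier G" ?c by (rule action_by_conjugation)
  interpret N: normal N G by (rule N)
  have fin: "finite (carrier G)" using ord p order_gt_0_iff_finite by (simp add: prime_gt_0_nat)
  \<comment> \<open>The orbit decomposition is a statement about sums over the whole group; this
    indicator makes such a sum count \<open>N - {\<one>}\<close>.\<close>
  let ?f = "\<lambda>x. if x \<in> N - {\<one>} then 1 else 0 :: nat"
  have orbitsE: "\<exists>x\<in>E. B = orbit G \<phi> x" if "B \<in> orbits G E \<phi>" for B E and \<phi> :: "'a \<Rightarrow> 'a \<Rightarrow> 'a"
    using that by (auto simp: orbits_def)
  \<comment> \<open>Since \<open>N - {\<one>}\<close> is closed under conjugation, an orbit avoids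
    it or lies inside it. Inside, the orbit length is a power of \<open>p\<close>, and it is not 1
    because \<open>x\<close> is not central.\<close>
  have orb: "p dvd sum ?f B" if B: "B \<in> orbits G (carrier G) ?c" for B
  proof -
    obtain x where x: "x \<in> carrier G" "B = orbit G ?c x" using orbitsE[OF B] by blast
    have mem: "x \<in> B" using x c.orbit_refl by simp
    show ?thesis
    proof (cases "x \<in> N - {\<one>}")
      case False
      have "y \<notin> N - {\<one>}" if "y \<in> B" for y
      proof
        assume y: "y \<in> N - {\<one>}"
        have "x \<in> orbit G ?c y"
          using c.orbit_sym[of x y] x y that by auto
        then obtain g where g: "g \<in> carrier G" "x = g \<otimes> y \<otimes> inv g"
          using y by (auto simp: orbit_def)
        then have "x \<in> N" using y N.inv_op_closed2 by simp
        moreover have "x \<noteq> \<one>"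
        proof
          assume "x = \<one>"
          then have "g \<otimes> y = g" using g y by (metis DiffE N.mem_carrier inv_solve_right' m_closed one_closed l_one)
          then show False using g y by (metis DiffE N.mem_carrier l_cancel_one singletonI)
        qed
        ultimately show False using False by simp
      qed
      then have "sum ?f B = 0" by (intro sum.neutral) auto
      then show ?thesis by simp
    next
      case True
      have "y \<in> N - {\<one>}" if y: "y \<in> B" for y
      proof -
        obtain g where g: "g \<in> carrier G" "y = g \<otimes> x \<otimes> inv g"
          using y x by (auto simp: orbit_def)
        then have "y \<in> N" using True N.inv_op_closed2 by simp
        moreover have "y \<noteq> \<one>"
        proof
          assume "y = \<one>"
          then have "g \<otimes> x = g" using g x by (metis inv_solve_right' m_closed one_closed l_one)
          then show False using g x True by (metis DiffE l_cancel_one singletonI m_closed r_one)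
        qed
        ultimately show ?thesis by simp
      qed
      then have sum: "sum ?f B = card B" by simp
      have "card B dvd p ^ n"
        unfolding x(2) ord[symmetric] c.orbit_stabilizer_theorem[OF x(1), symmetric] by (rule dvd_triv_left)
      then obtain j where j: "card B = p ^ j" using p divides_primepow_nat by blast
      obtain g where g: "g \<in> carrier G" "g \<otimes> x \<noteq> x \<otimes> g" using no True by blast
      have "g \<otimes> x \<otimes> inv g \<noteq> x" using g x by (metis inv_solve_right' m_closed)
      moreover have "g \<otimes> x \<otimes> inv g \<in> B" using g x by (auto simp: orbit_def)
      ultimately have "card B \<noteq> 1" using mem by (auto simp: card_1_singleton_iff)
      then have "j \<noteq> 0" using j by (metis power_0)
      then show ?thesis using sum j by (simp add: dvd_power)
    qed
  qed
  have "sum ?f (carrier G) = card (N - {\<one>})"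
    using fin N.subset by (subst sum.inter_restrict[symmetric]) (auto simp: Int_absorb1 Diff_subset[THEN subset_trans])
  then have dvdN: "p dvd card (N - {\<one>})"
    using c.disjoint_sum[OF fin, of ?f] orb by (metis (no_types, lifting) dvd_sum)
  have "finite N" using fin N.subset finite_subset by blast
  then have cN: "card N = Suc (card (N - {\<one>}))" by (metis N.one_closed card.remove)
  have "card N dvd p ^ n" using lagrange[OF N.is_subgroup] ord by (metis dvd_triv_right)
  then obtain j where j: "card N = p ^ j" using p divides_primepow_nat by blast
  have "card N \<noteq> 1" using N(2) N.one_closed by (metis card_1_singletonE singletonD)
  then have "p dvd card N" using j by (cases j) auto
  then have "p dvd 1" using cN dvdN by (metis Suc_eq_plus1_left dvd_add_left_iff)
  then show False using p by auto
qed

section \<open>Generation, cosets, normalizers and permutation groups\<close>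

lemma (in group) generate_Un_generate:
  assumes "A \<subseteq> carrier G" "B \<subseteq> carrier G"
  shows "generate G (A \<union> generate G B) = generate G (A \<union> B)"
proof
  have AB: "A \<union> B \<subseteq> carrier G" using assms by simp
  show "generate G (A \<union> generate G B) \<subseteq> generate G (A \<union> B)"
    using mono_generate[of B "A \<union> B"] AB
    by (intro generate_subgroup_incl generate_is_subgroup) (auto intro: generate.incl)
  show "generate G (A \<union> B) \<subseteq> generate G (A \<union> generate G B)"
    by (rule mono_generate) (auto intro: generate.incl)
qed

lemma (in group) generate_subgroup:
  assumes "subgroup H G" "A \<subseteq> H"
  shows "generate G (A \<union> H) = H"
  using assms generate_subgroup_incl[of "A \<union> H" H] by (auto intro: generate.incl)

lemma (in normal) r_coset_eq_iff:
  assumes "a \<in> carrier G" "b \<in> carrier G"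
  shows "H #> a = H #> b \<longleftrightarrow> a \<otimes> inv b \<in> H"
  using assms by (metis is_group is_subgroup rcos_module repr_independence repr_independenceD rcos_self)

lemma (in group) normalizer_subset: "normalizer G H \<subseteq> carrier G"
  by (auto simp: normalizer_def stabilizer_def)

text \<open>For finite \<open>H\<close> the inclusion of \<open>H\<close> in its conjugate by
  \<open>g\<close> is an equality by counting. The condition therefore needs one direction only, the
  one used by \<open>conj_map\<close>.\<close>

lemma (in group) mem_normalizerI:
  assumes H: "subgroup H G" "finite H" and g: "g \<in> carrier G"
    and conj: "\<And>u. u \<in> H \<Longrightarrow> inv g \<otimes> u \<otimes> g \<in> H"
  shows "g \<in> normalizer G H"
proof -
  have c: "u \<in> carrier G" if "u \<in> H" for u using H that by (simp add: subgroup.mem_carrier)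
  have eq: "g <# H #> inv g = (\<lambda>u. g \<otimes> u \<otimes> inv g) ` H"
    by (auto simp: l_coset_def r_coset_def)
  have "H \<subseteq> (\<lambda>u. g \<otimes> u \<otimes> inv g) ` H"
  proof
    fix u assume u: "u \<in> H"
    have "u = g \<otimes> (inv g \<otimes> u \<otimes> g) \<otimes> inv g" using conjugation_is_surj g c u by simp
    then show "u \<in> (\<lambda>u. g \<otimes> u \<otimes> inv g) ` H" using conj[OF u] by (rule image_eqI)
  qed
  then have "H = g <# H #> inv g"
    unfolding eq using H(2) by (intro card_seteq card_image_le) auto
  then show ?thesis using g c by (auto simp: normalizer_def stabilizer_def)
qed

lemma (in normal) normalizer_eq: "finite H \<Longrightarrow> normalizer G H = carrier G"
  using mem_normalizerI[OF is_subgroup] inv_op_closed1 normalizer_subset by blast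

lemma carrier_BijGroup: "carrier (BijGroup S) = Bij S"
  by (simp add: BijGroup_def)

lemma mult_BijGroup: "\<lbrakk>f \<in> Bij S; g \<in> Bij S\<rbrakk> \<Longrightarrow> f \<otimes>\<^bsub>BijGroup S\<^esub> g = compose S f g"
  by (simp add: BijGroup_def)

lemma one_BijGroup: "\<one>\<^bsub>BijGroup S\<^esub> = (\<lambda>x\<in>S. x)"
  by (simp add: BijGroup_def)

text \<open>Turns a relation between group powers of an automorphism into one between iterates,
  which can be evaluated at points.\<close>

lemma BijGroup_pow:
  assumes "\<theta> \<in> Bij S" "x \<in> S"
  shows "(\<theta> [^]\<^bsub>BijGroup S\<^esub> (k::nat)) x = (\<theta> ^^ k) x"
  using assms(2)
proof (induction k arbitrary: x)
  case 0
  then show ?case by (simp add: one_BijGroup)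
next
  case (Suc k)
  interpret B: group "BijGroup S" by (rule group_BijGroup)
  have "\<theta> [^]\<^bsub>BijGroup S\<^esub> k \<in> Bij S"
    using B.nat_pow_closed[of \<theta> k] assms(1) by (simp add: carrier_BijGroup)
  then have "\<theta> [^]\<^bsub>BijGroup S\<^esub> Suc k = compose S (\<theta> [^]\<^bsub>BijGroup S\<^esub> k) \<theta>"
    using assms(1) by (simp add: mult_BijGroup)
  moreover have "\<theta> x \<in> S" using Bij_imp_funcset[OF assms(1)] Suc.prems by (rule funcset_mem)
  ultimately show ?case using Suc.IH[of "\<theta> x"] Suc.prems by (simp add: compose_def funpow_swap1)
qed

section \<open>Fusion systems and strongly closed subgroups\<close>

context fusion_system
begin

lemma mor_subgroup: "\<phi> \<in> F Q R \<Longrightarrow> subgroup Q P" "\<phi> \<in> F Q R \<Longrightarrow> subgroup R P"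
  using objects by auto

lemma mor_hom: "\<lbrakk>\<phi> \<in> F Q R; x \<in> Q; y \<in> Q\<rbrakk> \<Longrightarrow> \<phi> (x \<otimes> y) = \<phi> x \<otimes> \<phi> y"
  using morphism[of \<phi> Q R] by (auto simp: mon_def hom_def)

lemma mor_closed: "\<lbrakk>\<phi> \<in> F Q R; x \<in> Q\<rbrakk> \<Longrightarrow> \<phi> x \<in> R"
  using morphism[of \<phi> Q R] by (auto simp: mon_def hom_def)

lemma mor_inj: "\<phi> \<in> F Q R \<Longrightarrow> inj_on \<phi> Q"
  using morphism[of \<phi> Q R] by (auto simp: mon_def)

lemma mor_extensional: "\<phi> \<in> F Q R \<Longrightarrow> \<phi> \<in> extensional Q"
  using morphism by blast

lemma mor_dom_carrier: "\<lbrakk>\<phi> \<in> F Q R; x \<in> Q\<rbrakk> \<Longrightarrow> x \<in> carrier P"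
  using mor_subgroup(1) subgroup.mem_carrier by metis

lemma mor_carrier: "\<lbrakk>\<phi> \<in> F Q R; x \<in> Q\<rbrakk> \<Longrightarrow> \<phi> x \<in> carrier P"
  using mor_closed mor_subgroup(2) subgroup.mem_carrier by metis

lemma mor_one: "\<phi> \<in> F Q R \<Longrightarrow> \<phi> \<one> = \<one>"
  using mor_hom[of \<phi> Q R \<one> \<one>] mor_carrier[of \<phi> Q R \<one>] mor_subgroup(1)[of \<phi> Q R]
  by (simp add: subgroup.one_closed l_cancel_one)

lemma mor_inv:
  assumes "\<phi> \<in> F Q R" "x \<in> Q"
  shows "\<phi> (inv x) = inv (\<phi> x)"
proof (rule sym, rule inv_equality)
  have Q: "subgroup Q P" "x \<in> carrier P" "inv x \<in> Q"
    using assms mor_subgroup mor_dom_carrier by (auto simp: subgroup.m_inv_closed)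
  then show "\<phi> (inv x) \<otimes> \<phi> x = \<one>"
    using mor_hom[OF assms(1) Q(3) assms(2)] mor_one[OF assms(1)] by simp
  show "\<phi> x \<in> carrier P" "\<phi> (inv x) \<in> carrier P" using mor_carrier assms Q by auto
qed

lemma inclusion:
  assumes "subgroup Q P" "subgroup R P" "Q \<subseteq> R"
  shows "(\<lambda>x\<in>Q. x) \<in> F Q R"
proof -
  have "conj_map P \<one> Q = (\<lambda>x\<in>Q. x)"
    using assms(1) by (auto simp: conj_map_def fun_eq_iff subgroup.mem_carrier)
  then show ?thesis using conj[OF assms(1,2) one_closed] assms(3) by auto
qed

lemma restriction:
  assumes "\<phi> \<in> F Q R" "subgroup Q' P" "Q' \<subseteq> Q" "subgroup R' P" "\<phi> ` Q' \<subseteq> R'"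
  shows "restrict \<phi> Q' \<in> F Q' R'"
proof -
  have "compose Q' \<phi> (\<lambda>x\<in>Q'. x) \<in> F Q' R"
    using comp[OF inclusion assms(1)] assms mor_subgroup(1) by blast
  then have "restrict \<phi> Q' \<in> F Q' R"
    by (simp add: compose_def restrict_def cong: if_cong)
  then have "restrict \<phi> Q' \<in> F Q' (\<phi> ` Q')"
    using image by (metis (no_types, lifting) image_restrict_eq)
  then have "compose Q' (\<lambda>x\<in>\<phi> ` Q'. x) (restrict \<phi> Q') \<in> F Q' R'"
    using comp inclusion mor_subgroup(2) assms(4,5) by blast
  moreover have "compose Q' (\<lambda>x\<in>\<phi> ` Q'. x) (restrict \<phi> Q') = restrict \<phi> Q'"
    by (auto simp: compose_def fun_eq_iff)
  ultimately show ?thesis by simp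
qed

lemma change_codomain:
  assumes "\<phi> \<in> F Q R" "subgroup S P" "\<phi> ` Q \<subseteq> S"
  shows "\<phi> \<in> F Q S"
  using restriction[OF assms(1) mor_subgroup(1)[OF assms(1)] order_refl assms(2,3)]
    mor_extensional[OF assms(1)] by (simp add: extensional_restrict)

lemma mor_vimage_subgroup:
  assumes "\<phi> \<in> F Q R" "subgroup H P"
  shows "subgroup {x \<in> Q. \<phi> x \<in> H} P"
proof -
  have Q: "subgroup Q P" using assms mor_subgroup by blast
  show ?thesis
    using mor_hom[OF assms(1)] mor_inv[OF assms(1)] mor_one[OF assms(1)] assms(2) Q
      subgroup.one_closed[OF Q] subgroup.one_closed[OF assms(2)]
    by (intro subgroupI) (auto simp: subgroup.m_closed subgroup.m_inv_closed subgroup.mem_carrier)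
qed

lemma mor_generate_subset:
  assumes "\<phi> \<in> F Q R" "A \<subseteq> Q" "subgroup H P" "\<phi> ` A \<subseteq> H"
  shows "\<phi> ` generate P A \<subseteq> H"
  using generate_subgroup_incl[OF _ mor_vimage_subgroup[OF assms(1,3)], of A] assms(2,4) by auto

end

section \<open>Strong closure and the centre relative to a strongly closed subgroup\<close>

text \<open>Elementwise form; it agrees with the usual condition on subgroups of \<open>T\<close>
  because a morphism can be restricted to \<open>Q \<inter> T\<close>.\<close>

definition strongly_closed :: "('a, 'b) monoid_scheme \<Rightarrow> 'a hom_sets \<Rightarrow> 'a set \<Rightarrow> bool" where
  "strongly_closed P F T \<longleftrightarrow>
     subgroup T P \<and> (\<forall>Q R. \<forall>\<phi>\<in>F Q R. \<forall>x\<in>Q \<inter> T. \<phi> x \<in> T)"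

text \<open>For strongly closed \<open>T\<close> this is the preimage of Z(F/T), written inside
  \<open>P\<close> so that all terms of the ascending series are compared at one type. Only
  overgroups of \<open>T\<close> occur, as these represent the objects of F/T.\<close>

definition relative_centre ::
  "('a, 'b) monoid_scheme \<Rightarrow> 'a hom_sets \<Rightarrow> 'a set \<Rightarrow> 'a set" where
  "relative_centre P F T =
     {x \<in> carrier P. \<forall>Q R. \<forall>\<phi>\<in>F Q R. T \<subseteq> Q \<longrightarrow> T \<subseteq> R \<longrightarrow>
        (\<exists>\<psi>\<in>F (generate P (insert x Q)) (generate P (insert x R)).
          (\<forall>u\<in>Q. T #>\<^bsub>P\<^esub> \<psi> u = T #>\<^bsub>P\<^esub> \<phi> u) \<and> T #>\<^bsub>P\<^esub> \<psi> x = T #>\<^bsub>P\<^esub> x)}"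

text \<open>Every morphism, not only one between overgroups of \<open>T\<close>, induces a morphism
  modulo \<open>T\<close>. The relative centre constrains overgroups of \<open>T\<close> only; this
  property carries the constraint over to all morphisms.\<close>

definition liftable :: "('a, 'b) monoid_scheme \<Rightarrow> 'a hom_sets \<Rightarrow> 'a set \<Rightarrow> bool" where
  "liftable P F T \<longleftrightarrow>
     (\<forall>Q R. \<forall>\<phi>\<in>F Q R. \<exists>\<psi>\<in>F (generate P (T \<union> Q)) (generate P (T \<union> R)).
        \<forall>u\<in>Q. T #>\<^bsub>P\<^esub> \<psi> u = T #>\<^bsub>P\<^esub> \<phi> u)"

context fusion_system
begin

lemma strongly_closed_mem: "\<lbrakk>strongly_closed P F T; \<phi> \<in> F Q R; x \<in> Q; x \<in> T\<rbrakk> \<Longrightarrow> \<phi> x \<in> T"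
  by (auto simp: strongly_closed_def)

lemma strongly_closed_subgroup: "strongly_closed P F T \<Longrightarrow> subgroup T P"
  by (simp add: strongly_closed_def)

text \<open>Conjugations by elements of \<open>P\<close> are morphisms.\<close>

lemma strongly_closed_normal:
  assumes "strongly_closed P F T"
  shows "T \<lhd> P"
proof -
  have T: "subgroup T P" using assms strongly_closed_subgroup by blast
  have "g \<otimes> x \<otimes> inv g \<in> T" if "g \<in> carrier P" "x \<in> T" for g x
  proof -
    have c: "conj_map P (inv g) T ` T \<subseteq> carrier P"
      using that T by (auto simp: conj_map_def subgroup.mem_carrier)
    show ?thesis
      using strongly_closed_mem[OF assms conj[OF T subgroup_self inv_closed[OF that(1)] c] that(2,2)]
        that by (simp add: conj_map_def)
  qed
  then show ?thesis using T normal_inv_iff by blast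
qed

text \<open>The quotient of \<open>x\<close> by \<open>y\<close> lies in
  \<open>Q \<inter> T\<close>, which is mapped into \<open>T\<close>. Hence a morphism is well
  defined on cosets.\<close>

lemma mor_cong:
  assumes T: "strongly_closed P F T" and \<phi>: "\<phi> \<in> F Q R"
    and "x \<in> Q" "y \<in> Q" "T #> x = T #> y"
  shows "T #> \<phi> x = T #> \<phi> y"
proof -
  interpret T: normal T P using T by (rule strongly_closed_normal)
  have Q: "subgroup Q P" using \<phi> mor_subgroup by blast
  have "x \<in> carrier P" "y \<in> carrier P" using assms mor_dom_carrier by auto
  then have "x \<otimes> inv y \<in> T" using assms(5) T.r_coset_eq_iff by simp
  moreover have "inv y \<in> Q" "x \<otimes> inv y \<in> Q"
    using assms Q by (auto simp: subgroup.m_inv_closed subgroup.m_closed)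
  ultimately have "\<phi> x \<otimes> inv (\<phi> y) \<in> T"
    using strongly_closed_mem[OF T \<phi>] mor_hom[OF \<phi>] mor_inv[OF \<phi>] assms by metis
  then show ?thesis using T.r_coset_eq_iff mor_carrier[OF \<phi>] assms by simp
qed

text \<open>Allows the congruence of two morphisms modulo \<open>T\<close> to be checked on
  generators.\<close>

lemma equalizer_subgroup:
  assumes T: "strongly_closed P F T" and "\<phi> \<in> F Q R" "\<psi> \<in> F Q S"
  shows "subgroup {x \<in> Q. T #> \<psi> x = T #> \<phi> x} P"
proof -
  interpret T: normal T P using T by (rule strongly_closed_normal)
  have Q: "subgroup Q P" using assms mor_subgroup by blast
  note c = mor_carrier[OF assms(2)] mor_carrier[OF assms(3)]
  show ?thesis
  proof (rule subgroupI)
    show "{x \<in> Q. T #> \<psi> x = T #> \<phi> x} \<subseteq> carrier P"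
      using Q by (auto simp: subgroup.mem_carrier)
    have "\<one> \<in> {x \<in> Q. T #> \<psi> x = T #> \<phi> x}"
      using mor_one[OF assms(2)] mor_one[OF assms(3)] Q by (simp add: subgroup.one_closed)
    then show "{x \<in> Q. T #> \<psi> x = T #> \<phi> x} \<noteq> {}" by blast
    fix a assume a: "a \<in> {x \<in> Q. T #> \<psi> x = T #> \<phi> x}"
    have "T #> \<psi> (inv a) = T #> \<phi> (inv a)"
      using a c mor_inv[OF assms(2)] mor_inv[OF assms(3)] T.rcos_inv by (metis (mono_tags, lifting) mem_Collect_eq)
    then show "inv a \<in> {x \<in> Q. T #> \<psi> x = T #> \<phi> x}"
      using a Q by (simp add: subgroup.m_inv_closed)
    fix b assume b: "b \<in> {x \<in> Q. T #> \<psi> x = T #> \<phi> x}"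
    have "T #> \<psi> (a \<otimes> b) = T #> \<phi> (a \<otimes> b)"
      using a b mor_hom[OF assms(2)] mor_hom[OF assms(3)]
        T.rcos_sum[OF c(1) c(1), of a b] T.rcos_sum[OF c(2) c(2), of a b] by simp
    then show "a \<otimes> b \<in> {x \<in> Q. T #> \<psi> x = T #> \<phi> x}"
      using a b Q by (simp add: subgroup.m_closed)
  qed
qed

lemma relative_centreD:
  assumes "x \<in> relative_centre P F T" "\<phi> \<in> F Q R" "T \<subseteq> Q" "T \<subseteq> R"
  shows "\<exists>\<psi>\<in>F (generate P (insert x Q)) (generate P (insert x R)).
          (\<forall>u\<in>Q. T #> \<psi> u = T #> \<phi> u) \<and> T #> \<psi> x = T #> x"
  using assms by (simp add: relative_centre_def)

lemma liftableD:
  assumes "liftable P F T" "\<phi> \<in> F Q R"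
  shows "\<exists>\<psi>\<in>F (generate P (T \<union> Q)) (generate P (T \<union> R)). \<forall>u\<in>Q. T #> \<psi> u = T #> \<phi> u"
  using assms by (simp add: liftable_def)

text \<open>The elements of \<open>A\<close> are adjoined one at a time. Each step may alter the
  earlier values, but only modulo \<open>T\<close>, so the congruences on \<open>Q\<close> and on
  the elements already adjoined survive.\<close>

lemma relative_centre_extend:
  assumes T: "strongly_closed P F T" and A: "finite A" "A \<subseteq> relative_centre P F T"
    and \<phi>: "\<phi> \<in> F Q R" and TQ: "T \<subseteq> Q" "T \<subseteq> R"
  shows "\<exists>\<psi>\<in>F (generate P (A \<union> Q)) (generate P (A \<union> R)).
           (\<forall>u\<in>Q. T #> \<psi> u = T #> \<phi> u) \<and> (\<forall>x\<in>A. T #> \<psi> x = T #> x)"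
  using A
proof (induction A)
  case empty
  have "generate P Q = Q" "generate P R = R"
    using generate_subgroup[of _ "{}"] mor_subgroup[OF \<phi>] by auto
  then show ?case using \<phi> by auto
next
  case (insert x A)
  have Q: "Q \<subseteq> carrier P" "R \<subseteq> carrier P" using mor_subgroup[OF \<phi>] subgroup.subset by auto
  have A: "A \<subseteq> carrier P" and x: "x \<in> carrier P" "x \<in> relative_centre P F T"
    using insert.prems by (auto simp: relative_centre_def)
  obtain \<psi> where \<psi>: "\<psi> \<in> F (generate P (A \<union> Q)) (generate P (A \<union> R))"
    "\<And>u. u \<in> Q \<Longrightarrow> T #> \<psi> u = T #> \<phi> u" "\<And>y. y \<in> A \<Longrightarrow> T #> \<psi> y = T #> y"
    using insert by auto
  have "T \<subseteq> generate P (A \<union> Q)" "T \<subseteq> generate P (A \<union> R)" using TQ by (auto intro: generate.incl)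
  then obtain \<chi> where \<chi>: "\<chi> \<in> F (generate P (insert x (generate P (A \<union> Q)))) (generate P (insert x (generate P (A \<union> R))))"
    "\<And>u. u \<in> generate P (A \<union> Q) \<Longrightarrow> T #> \<chi> u = T #> \<psi> u" "T #> \<chi> x = T #> x"
    using relative_centreD[OF x(2) \<psi>(1)] by blast
  have eq: "generate P (insert x (generate P (A \<union> S))) = generate P (insert x A \<union> S)"
    if "S \<subseteq> carrier P" for S
    using generate_Un_generate[of "{x}" "A \<union> S"] x A that by simp
  show ?case
  proof (intro bexI conjI ballI)
    show "\<chi> \<in> F (generate P (insert x A \<union> Q)) (generate P (insert x A \<union> R))"
      using \<chi>(1) eq Q by simp
    show "T #> \<chi> u = T #> \<phi> u" if "u \<in> Q" for u
      using that \<chi>(2) \<psi>(2) by (simp add: generate.incl)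
    show "T #> \<chi> y = T #> y" if "y \<in> insert x A" for y
      using that \<chi>(2,3) \<psi>(3) by (auto simp: generate.incl)
  qed
qed

text \<open>The definition treats one element at a time, so closure under products is not immediate.
  One extension that fixes all of \<open>A\<close> modulo \<open>T\<close> also fixes everything
  generated by \<open>A\<close>, and it can then be restricted to the subgroup generated by
  \<open>x\<close> and \<open>Q\<close>.\<close>

lemma generate_relative_centre:
  assumes T: "strongly_closed P F T" and A: "finite A" "A \<subseteq> relative_centre P F T"
    and x: "x \<in> generate P A"
  shows "x \<in> relative_centre P F T"
  unfolding relative_centre_def
proof (intro CollectI conjI allI ballI impI)
  have Ac: "A \<subseteq> carrier P" using A by (auto simp: relative_centre_def)
  show xc: "x \<in> carrier P" using x Ac generate_in_carrier by blast
  fix Q R \<phi> assume \<phi>: "\<phi> \<in> F Q R" and TQ: "T \<subseteq> Q" "T \<subseteq> R"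
  interpret T: normal T P using T by (rule strongly_closed_normal)
  have Q: "subgroup Q P" "subgroup R P" using mor_subgroup[OF \<phi>] by auto
  note Qc = Q[THEN subgroup.subset]
  obtain \<psi> where \<psi>: "\<psi> \<in> F (generate P (A \<union> Q)) (generate P (A \<union> R))"
    "\<And>u. u \<in> Q \<Longrightarrow> T #> \<psi> u = T #> \<phi> u" "\<And>y. y \<in> A \<Longrightarrow> T #> \<psi> y = T #> y"
    using relative_centre_extend[OF T A \<phi> TQ] by blast
  let ?D = "generate P (A \<union> Q)"
  have D: "subgroup ?D P" using mor_subgroup[OF \<psi>(1)] by blast
  \<comment> \<open>Comparing \<open>\<psi>\<close> with the inclusion: the elements fixed modulo
    \<open>T\<close> form a subgroup, and it contains \<open>A\<close>.\<close>
  have "subgroup {y \<in> ?D. T #> \<psi> y = T #> (\<lambda>y\<in>?D. y) y} P"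
    using equalizer_subgroup[OF T inclusion[OF D D] \<psi>(1)] by simp
  moreover have "A \<subseteq> {y \<in> ?D. T #> \<psi> y = T #> (\<lambda>y\<in>?D. y) y}"
    using \<psi>(3) by (auto simp: generate.incl)
  ultimately have "x \<in> {y \<in> ?D. T #> \<psi> y = T #> (\<lambda>y\<in>?D. y) y}"
    using x generate_subgroup_incl by blast
  then have x': "x \<in> ?D" "T #> \<psi> x = T #> x" by auto
  have sub: "insert x Q \<subseteq> ?D" using x' by (auto intro: generate.incl)
  have E: "subgroup (generate P (insert x R)) P" "subgroup (generate P (insert x Q)) P"
    using xc Qc by (auto intro!: generate_is_subgroup)
  \<comment> \<open>Since \<open>R\<close> contains \<open>T\<close>, changing a value modulo
    \<open>T\<close> does not leave the required codomain.\<close>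
  have mem: "\<psi> u \<in> generate P (insert x R)"
    if "u \<in> ?D" "v \<in> generate P (insert x R)" "T #> \<psi> u = T #> v" for u v
  proof -
    have "v \<in> carrier P" "\<psi> u \<in> carrier P"
      using that E mor_carrier[OF \<psi>(1)] by (auto simp: subgroup.mem_carrier)
    then have "\<psi> u \<otimes> inv v \<in> T" "\<psi> u = \<psi> u \<otimes> inv v \<otimes> v"
      using that(3) T.r_coset_eq_iff by (auto simp: m_assoc)
    moreover from this have "\<psi> u \<otimes> inv v \<in> generate P (insert x R)"
      using TQ by (auto intro: generate.incl)
    ultimately show ?thesis using that(2) E(1) subgroup.m_closed by metis
  qed
  have "\<psi> u \<in> generate P (insert x R)" if "u \<in> insert x Q" for u
  proof (cases "u = x")
    case True
    then show ?thesis using mem[of x x] x' by (simp add: generate.incl)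
  next
    case False
    then show ?thesis using mem[of u "\<phi> u"] that sub \<psi>(2) mor_closed[OF \<phi>] by (auto simp: generate.incl)
  qed
  then have "\<psi> ` generate P (insert x Q) \<subseteq> generate P (insert x R)"
    using mor_generate_subset[OF \<psi>(1) sub E(1)] by blast
  then have "restrict \<psi> (generate P (insert x Q)) \<in> F (generate P (insert x Q)) (generate P (insert x R))"
    using restriction[OF \<psi>(1) E(2) _ E(1)] generate_subgroup_incl[OF sub D] by blast
  then show "\<exists>\<psi>\<in>F (generate P (insert x Q)) (generate P (insert x R)).
       (\<forall>u\<in>Q. T #> \<psi> u = T #> \<phi> u) \<and> T #> \<psi> x = T #> x"
    using \<psi>(2) x'(2) by (intro bexI) (auto simp: generate.incl)
qed

lemma subset_relative_centre:
  assumes T: "strongly_closed P F T"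
  shows "T \<subseteq> relative_centre P F T"
  unfolding relative_centre_def
proof (intro subsetI CollectI conjI allI ballI impI)
  interpret T: normal T P using T by (rule strongly_closed_normal)
  fix x assume x: "x \<in> T"
  then show "x \<in> carrier P" by simp
  fix Q R \<phi> assume \<phi>: "\<phi> \<in> F Q R" and TQ: "T \<subseteq> Q" "T \<subseteq> R"
  have "generate P (insert x Q) = Q" "generate P (insert x R) = R"
    using generate_subgroup[of _ "{x}"] mor_subgroup[OF \<phi>] x TQ by auto
  moreover have "T #> \<phi> x = T #> x"
    using strongly_closed_mem[OF T \<phi>] x TQ by (simp add: T.rcos_const subset_iff)
  ultimately show "\<exists>\<psi>\<in>F (generate P (insert x Q)) (generate P (insert x R)).
       (\<forall>u\<in>Q. T #> \<psi> u = T #> \<phi> u) \<and> T #> \<psi> x = T #> x" using \<phi> by auto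
qed

end

locale finite_fusion_system = fusion_system +
  assumes finite_P: "finite (carrier P)"
begin

text \<open>By finiteness the previous closure result applies to the whole relative centre as
  generating set.\<close>

lemma relative_centre_subgroup:
  assumes T: "strongly_closed P F T"
  shows "subgroup (relative_centre P F T) P"
proof -
  have c: "relative_centre P F T \<subseteq> carrier P" by (auto simp: relative_centre_def)
  then have "finite (relative_centre P F T)" using finite_P finite_subset by blast
  then have "generate P (relative_centre P F T) = relative_centre P F T"
    using generate_relative_centre[OF T] by (auto intro: generate.incl)
  then show ?thesis using generate_is_subgroup[OF c] by simp
qed

text \<open>Liftability first brings \<open>T\<close> into the domain; then the whole relative
  centre is adjoined. Strong closure and liftability of the next term both follow from this one
  extension.\<close>

lemma relative_centre_lift:
  assumes T: "strongly_closed P F T" "liftable P F T" and \<phi>: "\<phi> \<in> F Q R"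
  shows "\<exists>\<psi>\<in>F (generate P (relative_centre P F T \<union> Q)) (generate P (relative_centre P F T \<union> R)).
     (\<forall>u\<in>Q. T #> \<psi> u = T #> \<phi> u) \<and> (\<forall>x\<in>relative_centre P F T. T #> \<psi> x = T #> x)"
proof -
  let ?Z = "relative_centre P F T"
  have Zc: "?Z \<subseteq> carrier P" by (auto simp: relative_centre_def)
  have Z: "finite ?Z" "T \<subseteq> ?Z"
    using finite_P finite_subset[OF Zc] subset_relative_centre[OF T(1)] by auto
  have Q: "Q \<subseteq> carrier P" "R \<subseteq> carrier P" using mor_subgroup[OF \<phi>] subgroup.subset by auto
  obtain \<psi> where \<psi>: "\<psi> \<in> F (generate P (T \<union> Q)) (generate P (T \<union> R))"
    "\<And>u. u \<in> Q \<Longrightarrow> T #> \<psi> u = T #> \<phi> u"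
    using liftableD[OF T(2) \<phi>] by blast
  have "T \<subseteq> generate P (T \<union> Q)" "T \<subseteq> generate P (T \<union> R)" by (auto intro: generate.incl)
  then obtain \<chi> where \<chi>: "\<chi> \<in> F (generate P (?Z \<union> generate P (T \<union> Q))) (generate P (?Z \<union> generate P (T \<union> R)))"
    "\<And>u. u \<in> generate P (T \<union> Q) \<Longrightarrow> T #> \<chi> u = T #> \<psi> u" "\<And>y. y \<in> ?Z \<Longrightarrow> T #> \<chi> y = T #> y"
    using relative_centre_extend[OF T(1) Z(1) order_refl \<psi>(1)] by blast
  have "generate P (?Z \<union> generate P (T \<union> S)) = generate P (?Z \<union> S)" if "S \<subseteq> carrier P" for S
    using generate_Un_generate[OF Zc, of "T \<union> S"] Z(2) Zc that
    by (metis (no_types, lifting) Un_assoc Un_least le_sup_iff subset_trans sup.absorb1)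
  then have "\<chi> \<in> F (generate P (?Z \<union> Q)) (generate P (?Z \<union> R))" using \<chi>(1) Q by simp
  then show ?thesis using \<chi>(2,3) \<psi>(2) by (intro bexI[of _ \<chi>]) (auto simp: generate.incl)
qed

text \<open>Both conditions on the lift apply to \<open>x\<close>, which lies in \<open>Q\<close>
  and in the relative centre; they give the coset of its value twice.\<close>

lemma mor_relative_centre:
  assumes T: "strongly_closed P F T" "liftable P F T" and \<phi>: "\<phi> \<in> F Q R"
    and x: "x \<in> Q" "x \<in> relative_centre P F T"
  shows "T #> \<phi> x = T #> x"
  using relative_centre_lift[OF T \<phi>] x by metis

lemma relative_centre_strongly_closed:
  assumes T: "strongly_closed P F T" "liftable P F T"
  shows "strongly_closed P F (relative_centre P F T)"
  unfolding strongly_closed_def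
proof (intro conjI allI ballI)
  interpret T: normal T P using T by (intro strongly_closed_normal)
  show Z: "subgroup (relative_centre P F T) P" using T(1) by (rule relative_centre_subgroup)
  fix Q R \<phi> x assume \<phi>: "\<phi> \<in> F Q R" and x: "x \<in> Q \<inter> relative_centre P F T"
  have c: "x \<in> carrier P" "\<phi> x \<in> carrier P" using x mor_dom_carrier[OF \<phi>] mor_carrier[OF \<phi>] by auto
  have "\<phi> x \<otimes> inv x \<in> T" using mor_relative_centre[OF T \<phi>, of x] x c T.r_coset_eq_iff by blast
  then have "\<phi> x \<otimes> inv x \<otimes> x \<in> relative_centre P F T"
    using subset_relative_centre[OF T(1)] x Z by (auto simp: subgroup.m_closed)
  then show "\<phi> x \<in> relative_centre P F T" using c by (simp add: m_assoc)
qed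

lemma relative_centre_liftable:
  assumes T: "strongly_closed P F T" "liftable P F T"
  shows "liftable P F (relative_centre P F T)"
  unfolding liftable_def
proof (intro allI ballI)
  let ?Z = "relative_centre P F T"
  interpret T: normal T P using T by (intro strongly_closed_normal)
  interpret Z: normal ?Z P using relative_centre_strongly_closed[OF T] by (intro strongly_closed_normal)
  fix Q R \<phi> assume \<phi>: "\<phi> \<in> F Q R"
  obtain \<psi> where \<psi>: "\<psi> \<in> F (generate P (?Z \<union> Q)) (generate P (?Z \<union> R))"
    "\<And>u. u \<in> Q \<Longrightarrow> T #> \<psi> u = T #> \<phi> u"
    using relative_centre_lift[OF T \<phi>] by blast
  have "?Z #> \<psi> u = ?Z #> \<phi> u" if "u \<in> Q" for u
    using that \<psi>(2)[OF that] subset_relative_centre[OF T(1)] mor_carrier[OF \<phi> that]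
      mor_carrier[OF \<psi>(1), of u] T.r_coset_eq_iff Z.r_coset_eq_iff by (auto simp: generate.incl)
  then show "\<exists>\<psi>\<in>F (generate P (?Z \<union> Q)) (generate P (?Z \<union> R)). \<forall>u\<in>Q. ?Z #> \<psi> u = ?Z #> \<phi> u"
    using \<psi>(1) by blast
qed

end

section \<open>The ascending central series\<close>

context fusion_system
begin

text \<open>The correspondence theorem: the subgroups quantified existentially in
  \<open>quotient_system\<close> are determined by the two objects.\<close>

lemma quotient_object_eq_iff:
  assumes T: "T \<lhd> P" and "subgroup Q P" "subgroup Q' P" "T \<subseteq> Q" "T \<subseteq> Q'"
  shows "quotient_object P T Q = quotient_object P T Q' \<longleftrightarrow> Q = Q'"
proof
  interpret T: normal T P by (rule T)
  have "A \<subseteq> B" if eq: "quotient_object P T A = quotient_object P T B"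
    and A: "subgroup A P" and B: "subgroup B P" and sub: "T \<subseteq> B" for A B
  proof
    fix a assume a: "a \<in> A"
    have "T #> a \<in> (\<lambda>x. T #> x) ` A" using a by (rule imageI)
    then have "T #> a \<in> (\<lambda>x. T #> x) ` B" using eq unfolding quotient_object_def by simp
    then obtain b where b: "b \<in> B" "T #> a = T #> b" by blast
    have c: "a \<in> carrier P" "b \<in> carrier P" using A B a b by (auto simp: subgroup.mem_carrier)
    then have "a \<otimes> inv b \<in> T" using b T.r_coset_eq_iff by simp
    then have "a \<otimes> inv b \<otimes> b \<in> B" using b sub subgroup.m_closed[OF B] by blast
    then show "a \<in> B" using c by (simp add: m_assoc)
  qed
  then show "quotient_object P T Q = quotient_object P T Q' \<Longrightarrow> Q = Q'" using assms by (simp add: subset_antisym)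
qed simp

lemma generate_quotient_object:
  assumes T: "T \<lhd> P" and "A \<subseteq> carrier P"
  shows "generate (P Mod T) (quotient_object P T A) = quotient_object P T (generate P A)"
proof -
  interpret T: normal T P by (rule T)
  interpret h: group_hom P "P Mod T" "\<lambda>x. T #> x"
    using T.r_coset_hom_Mod T.factorgroup_is_group 
    by (intro group_hom.intro group_hom_axioms.intro is_group) auto
  show ?thesis using h.generate_img[OF assms(2)] by (simp add: quotient_object_def)
qed

lemma induced_morphism:
  assumes T: "strongly_closed P F T" and \<phi>: "\<phi> \<in> F Q R" and TQ: "T \<subseteq> Q" "T \<subseteq> R"
  shows "\<exists>\<phi>'\<in>quotient_system P F T (quotient_object P T Q) (quotient_object P T R).
           \<forall>x\<in>Q. \<phi>' (T #> x) = T #> \<phi> x"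
proof -
  \<comment> \<open>An arbitrary representative of each coset is used; \<open>mor_cong\<close> makes
    the value independent of it.\<close>
  define \<phi>' where "\<phi>' = (\<lambda>C\<in>quotient_object P T Q. T #> \<phi> (SOME u. u \<in> Q \<and> T #> u = C))"
  have val: "\<phi>' (T #> x) = T #> \<phi> x" if x: "x \<in> Q" for x
  proof -
    let ?u = "SOME u. u \<in> Q \<and> T #> u = T #> x"
    have "?u \<in> Q \<and> T #> ?u = T #> x" by (rule someI[of _ x]) (simp add: x)
    then have "T #> \<phi> ?u = T #> \<phi> x" using mor_cong[OF T \<phi>] x by blast
    then show ?thesis using x by (simp add: \<phi>'_def quotient_object_def)
  qed
  have "\<phi>' \<in> quotient_system P F T (quotient_object P T Q) (quotient_object P T R)"
    unfolding quotient_system_def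
  proof (intro CollectI conjI exI bexI)
    show "\<phi>' \<in> extensional (quotient_object P T Q)" by (simp add: \<phi>'_def)
  qed (use val TQ \<phi> in auto)
  then show ?thesis using val by blast
qed

lemma quotient_systemE:
  assumes "\<phi>' \<in> quotient_system P F T Q' R'"
  obtains Q R \<phi> where "\<phi> \<in> F Q R" "T \<subseteq> Q" "T \<subseteq> R" "Q' = quotient_object P T Q"
    "R' = quotient_object P T R" "\<forall>x\<in>Q. \<phi>' (T #> x) = T #> \<phi> x"
  using assms unfolding quotient_system_def by (elim CollectE conjE exE bexE) (rule that)

text \<open>Morphisms of the quotient system are induced by morphisms between overgroups of
  \<open>T\<close>, and generation commutes with passing to cosets, so extensions can be moved in
  both directions.\<close>

lemma mem_centre_quotient_iff:
  assumes T: "strongly_closed P F T" and x: "x \<in> carrier P"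
  shows "T #> x \<in> centre (P Mod T) (quotient_system P F T) \<longleftrightarrow> x \<in> relative_centre P F T"
    (is "?l \<longleftrightarrow> ?r")
proof
  interpret T: normal T P using T by (rule strongly_closed_normal)
  have N: "T \<lhd> P" by (rule T.normal_axioms)
  have gen: "generate (P Mod T) (insert (T #> x) (quotient_object P T Q))
      = quotient_object P T (generate P (insert x Q))" if "subgroup Q P" for Q
    using generate_quotient_object[OF N, of "insert x Q"] x subgroup.subset[OF that]
    by (simp add: quotient_object_def)
  have sub: "subgroup (generate P (insert x Q)) P" if "subgroup Q P" for Q
    using x subgroup.subset[OF that] by (simp add: generate_is_subgroup)
  have mono: "T \<subseteq> generate P (insert x Q)" if "T \<subseteq> Q" for Q
    using that by (auto intro: generate.incl)
  show ?l if r: ?r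
    unfolding centre_def
  proof (intro CollectI conjI allI ballI)
    show "T #> x \<in> carrier (P Mod T)" using x by (simp add: carrier_FactGroup)
    fix Q' R' \<phi>' assume "\<phi>' \<in> quotient_system P F T Q' R'"
    then obtain Q R \<phi> where \<phi>: "\<phi> \<in> F Q R" and TQ: "T \<subseteq> Q" "T \<subseteq> R"
      and Q': "Q' = quotient_object P T Q" "R' = quotient_object P T R"
      and val: "\<forall>u\<in>Q. \<phi>' (T #> u) = T #> \<phi> u"
      by (rule quotient_systemE)
    obtain \<psi> where \<psi>: "\<psi> \<in> F (generate P (insert x Q)) (generate P (insert x R))"
      "\<And>u. u \<in> Q \<Longrightarrow> T #> \<psi> u = T #> \<phi> u" "T #> \<psi> x = T #> x"
      using relative_centreD[OF r \<phi> TQ] by blast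
    obtain \<psi>' where \<psi>': "\<psi>' \<in> quotient_system P F T (quotient_object P T (generate P (insert x Q)))
        (quotient_object P T (generate P (insert x R)))"
      "\<And>u. u \<in> generate P (insert x Q) \<Longrightarrow> \<psi>' (T #> u) = T #> \<psi> u"
      using induced_morphism[OF T \<psi>(1) mono[OF TQ(1)] mono[OF TQ(2)]] by blast
    show "\<exists>\<psi>'\<in>quotient_system P F T (generate (P Mod T) (insert (T #> x) Q'))
         (generate (P Mod T) (insert (T #> x) R')). (\<forall>u\<in>Q'. \<psi>' u = \<phi>' u) \<and> \<psi>' (T #> x) = T #> x"
    proof (intro bexI conjI ballI)
      show "\<psi>' \<in> quotient_system P F T (generate (P Mod T) (insert (T #> x) Q'))
         (generate (P Mod T) (insert (T #> x) R'))"
        using \<psi>'(1) gen mor_subgroup[OF \<phi>] Q' by simp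
      show "\<psi>' (T #> x) = T #> x" using \<psi>'(2) \<psi>(3) by (simp add: generate.incl)
      fix U assume "U \<in> Q'"
      then obtain u where "u \<in> Q" "U = T #> u" using Q' by (auto simp: quotient_object_def)
      then show "\<psi>' U = \<phi>' U" using \<psi>'(2) \<psi>(2) val by (simp add: generate.incl)
    qed
  qed
  show ?r if l: ?l
    unfolding relative_centre_def
  proof (intro CollectI conjI allI ballI impI x)
    fix Q R \<phi> assume \<phi>: "\<phi> \<in> F Q R" and TQ: "T \<subseteq> Q" "T \<subseteq> R"
    note Q = mor_subgroup[OF \<phi>]
    obtain \<phi>' where \<phi>': "\<phi>' \<in> quotient_system P F T (quotient_object P T Q) (quotient_object P T R)"
      "\<And>u. u \<in> Q \<Longrightarrow> \<phi>' (T #> u) = T #> \<phi> u"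
      using induced_morphism[OF T \<phi> TQ] by blast
    have "\<exists>\<psi>'\<in>quotient_system P F T (generate (P Mod T) (insert (T #> x) (quotient_object P T Q)))
         (generate (P Mod T) (insert (T #> x) (quotient_object P T R))).
           (\<forall>u\<in>quotient_object P T Q. \<psi>' u = \<phi>' u) \<and> \<psi>' (T #> x) = T #> x"
      using l \<phi>'(1) by (simp add: centre_def)
    then obtain \<psi>' where \<psi>': "\<psi>' \<in> quotient_system P F T (quotient_object P T (generate P (insert x Q)))
        (quotient_object P T (generate P (insert x R)))"
      "\<And>U. U \<in> quotient_object P T Q \<Longrightarrow> \<psi>' U = \<phi>' U" "\<psi>' (T #> x) = T #> x"
      using gen Q by auto
    obtain D E \<psi> where \<psi>: "\<psi> \<in> F D E" and TD: "T \<subseteq> D" "T \<subseteq> E"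
      and D: "quotient_object P T (generate P (insert x Q)) = quotient_object P T D"
        "quotient_object P T (generate P (insert x R)) = quotient_object P T E"
      and val: "\<forall>u\<in>D. \<psi>' (T #> u) = T #> \<psi> u"
      using \<psi>'(1) by (rule quotient_systemE)
    \<comment> \<open>The morphism inducing \<open>\<psi>'\<close> comes with its own domain and
      codomain; the correspondence of subgroups identifies them with the desired ones.\<close>
    have eq: "generate P (insert x Q) = D" "generate P (insert x R) = E"
      using quotient_object_eq_iff[OF N] D TD TQ mono mor_subgroup[OF \<psi>] sub Q by auto
    show "\<exists>\<psi>\<in>F (generate P (insert x Q)) (generate P (insert x R)).
       (\<forall>u\<in>Q. T #> \<psi> u = T #> \<phi> u) \<and> T #> \<psi> x = T #> x"
    proof (intro bexI conjI ballI)
      show "\<psi> \<in> F (generate P (insert x Q)) (generate P (insert x R))" using \<psi> eq by simp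
      show "T #> \<psi> x = T #> x" using val \<psi>'(3) eq by (auto simp: generate.incl)
      fix u assume u: "u \<in> Q"
      then have "u \<in> D" "T #> u \<in> quotient_object P T Q"
        using eq by (auto simp: generate.incl quotient_object_def)
      then show "T #> \<psi> u = T #> \<phi> u" using val \<psi>'(2) \<phi>'(2) u by metis
    qed
  qed
qed

section \<open>The terms of the series, starting from the trivial subgroup\<close>

lemma one_strongly_closed: "strongly_closed P F {\<one>}"
  using mor_one by (auto simp: strongly_closed_def triv_subgroup)

lemma r_coset_one: "a \<in> carrier P \<Longrightarrow> {\<one>} #> a = {a}"
  by (simp add: r_coset_def)

lemma one_liftable: "liftable P F {\<one>}"
  unfolding liftable_def
proof (intro allI ballI)
  fix Q R \<phi> assume \<phi>: "\<phi> \<in> F Q R"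
  have "generate P ({\<one>} \<union> S) = S" if "subgroup S P" for S
    using generate_subgroup[OF that, of "{\<one>}"] subgroup.one_closed[OF that] by simp
  then show "\<exists>\<psi>\<in>F (generate P ({\<one>} \<union> Q)) (generate P ({\<one>} \<union> R)). \<forall>u\<in>Q. {\<one>} #> \<psi> u = {\<one>} #> \<phi> u"
    using mor_subgroup[OF \<phi>] \<phi> by auto
qed

text \<open>Cosets of the trivial subgroup are singletons, so congruence becomes equality. This lets
  the first term of the series be treated like all later ones.\<close>

lemma centre_eq_relative_centre: "centre P F = relative_centre P F {\<one>}"
proof -
  have "(\<exists>\<psi>\<in>F (generate P (insert x Q)) (generate P (insert x R)). (\<forall>u\<in>Q. \<psi> u = \<phi> u) \<and> \<psi> x = x)
    \<longleftrightarrow> ({\<one>} \<subseteq> Q \<longrightarrow> {\<one>} \<subseteq> R \<longrightarrow> (\<exists>\<psi>\<in>F (generate P (insert x Q)) (generate P (insert x R)).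
          (\<forall>u\<in>Q. {\<one>} #> \<psi> u = {\<one>} #> \<phi> u) \<and> {\<one>} #> \<psi> x = {\<one>} #> x))"
    if x: "x \<in> carrier P" and \<phi>: "\<phi> \<in> F Q R" for x Q R \<phi>
  proof -
    have "{\<one>} \<subseteq> Q" "{\<one>} \<subseteq> R" using mor_subgroup[OF \<phi>] by (auto simp: subgroup.one_closed)
    moreover have "(\<forall>u\<in>Q. \<psi> u = \<phi> u) \<and> \<psi> x = x \<longleftrightarrow>
        (\<forall>u\<in>Q. {\<one>} #> \<psi> u = {\<one>} #> \<phi> u) \<and> {\<one>} #> \<psi> x = {\<one>} #> x"
      if "\<psi> \<in> F (generate P (insert x Q)) (generate P (insert x R))" for \<psi>
      using x mor_carrier[OF \<phi>] mor_carrier[OF that] by (simp add: r_coset_one generate.incl)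
    ultimately show ?thesis by (simp cong: bex_cong)
  qed
  then show ?thesis unfolding centre_def relative_centre_def by (auto 0 3)
qed

end

context finite_fusion_system
begin

text \<open>The two properties go through the induction together: strong closure identifies the next
  term with a relative centre, and both are needed to pass to that relative centre.\<close>

lemma centre_series_closed_liftable:
  "strongly_closed P F (centre_series P F n) \<and> liftable P F (centre_series P F n)"
  "centre_series P F (Suc n) = relative_centre P F (centre_series P F n)"
proof -
  have step: "centre_series P F (Suc n) = relative_centre P F (centre_series P F n)"
    if "strongly_closed P F (centre_series P F n)" for n
    using mem_centre_quotient_iff[OF that] by (auto simp: relative_centre_def)
  show *: "strongly_closed P F (centre_series P F n) \<and> liftable P F (centre_series P F n)" for n
  proof (induction n)
    case 0
    then show ?case
      using relative_centre_strongly_closed[OF one_strongly_closed one_liftable]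
        relative_centre_liftable[OF one_strongly_closed one_liftable]
      by (simp add: centre_eq_relative_centre)
  next
    case (Suc n)
    then show ?case
      using step relative_centre_strongly_closed relative_centre_liftable by metis
  qed
  show "centre_series P F (Suc n) = relative_centre P F (centre_series P F n)"
    using step * by blast
qed

lemma mor_centre: "\<lbrakk>\<phi> \<in> F Q R; x \<in> Q; x \<in> centre P F\<rbrakk> \<Longrightarrow> \<phi> x = x"
  using mor_relative_centre[OF one_strongly_closed one_liftable, of \<phi> Q R x]
    mor_dom_carrier[of \<phi> Q R x] mor_carrier[of \<phi> Q R x]
  by (simp add: centre_eq_relative_centre r_coset_one)

text \<open>Trivial action on the factors of the series; \<open>mor_centre\<close> is the
  corresponding statement for its bottom term.\<close>

lemma mor_centre_series:
  "\<lbrakk>\<phi> \<in> F Q R; x \<in> Q; x \<in> centre_series P F (Suc n)\<rbrakk> \<Longrightarrow> \<phi> x \<otimes> inv x \<in> centre_series P F n"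
  using mor_relative_centre[of "centre_series P F n" \<phi> Q R x] centre_series_closed_liftable[of n]
    mor_dom_carrier[of \<phi> Q R x] mor_carrier[of \<phi> Q R x]
    normal.r_coset_eq_iff[OF strongly_closed_normal, of "centre_series P F n"]
  by metis

lemma centre_series_mono: "m \<le> n \<Longrightarrow> centre_series P F m \<subseteq> centre_series P F n"
proof (rule lift_Suc_mono_le)
  show "centre_series P F n \<subseteq> centre_series P F (Suc n)" for n
    unfolding centre_series_closed_liftable(2)
    by (rule subset_relative_centre) (simp add: centre_series_closed_liftable)
qed

text \<open>\<open>GREATEST\<close> refers to inclusion. The range is finite, so it has a maximal
  term, and in an ascending chain this term is the greatest and the series is stationary from there
  on.\<close>

lemma hypercentre_is_term:
  obtains n where "hypercentre P F = centre_series P F n"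
    "centre_series P F (Suc n) = centre_series P F n"
proof -
  let ?Z = "centre_series P F"
  have "range ?Z \<subseteq> Pow (carrier P)"
    using centre_series_closed_liftable(1) strongly_closed_subgroup subgroup.subset by blast
  then have "finite (range ?Z)" using finite_P finite_subset by blast
  then obtain n where n: "\<And>m. ?Z n \<subseteq> ?Z m \<Longrightarrow> ?Z n = ?Z m"
    using finite_has_maximal[of "range ?Z"] by auto
  have ub: "?Z m \<subseteq> ?Z n" for m
    using n[of "max m n"] centre_series_mono[of n "max m n"] centre_series_mono[of m "max m n"]
    by auto
  have "hypercentre P F = ?Z n"
    unfolding hypercentre_def using ub by (intro Greatest_equality) auto
  moreover have "?Z (Suc n) = ?Z n"
    by (rule subset_antisym[OF ub centre_series_mono]) simp
  ultimately show thesis using that by blast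
qed

section \<open>Automorphisms congruent to the identity\<close>

lemma endo_Bij:
  assumes "\<phi> \<in> F Q Q"
  shows "\<phi> \<in> Bij Q"
proof -
  have "finite Q" using finite_P mor_subgroup[OF assms] by (meson finite_subset subgroup.subset)
  then have "\<phi> ` Q = Q" using mor_inj[OF assms] mor_closed[OF assms] by (intro endo_inj_surj) auto
  then show ?thesis using mor_inj[OF assms] mor_extensional[OF assms] by (auto simp: Bij_def bij_betw_def)
qed

lemma F_subgroup_BijGroup:
  assumes "subgroup Q P"
  shows "subgroup (F Q Q) (BijGroup Q)"
proof (rule subgroup.intro)
  show "F Q Q \<subseteq> carrier (BijGroup Q)" using endo_Bij by (auto simp: BijGroup_def)
  show "\<one>\<^bsub>BijGroup Q\<^esub> \<in> F Q Q" using inclusion[OF assms assms] by (simp add: BijGroup_def)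
  show "\<phi> \<otimes>\<^bsub>BijGroup Q\<^esub> \<psi> \<in> F Q Q" if "\<phi> \<in> F Q Q" "\<psi> \<in> F Q Q" for \<phi> \<psi>
    using that comp endo_Bij by (simp add: BijGroup_def)
  show "inv\<^bsub>BijGroup Q\<^esub> \<phi> \<in> F Q Q" if \<phi>: "\<phi> \<in> F Q Q" for \<phi>
    using inverse[OF \<phi>] endo_Bij[OF \<phi>] by (simp add: inv_BijGroup Bij_def bij_betw_def)
qed

lemma Aut_F_group: "subgroup Q P \<Longrightarrow> group (Aut_F F Q)"
  using group.subgroup_imp_group[OF group_BijGroup F_subgroup_BijGroup] by (simp add: Aut_F_def)

lemma Aut_F_carrier: "carrier (Aut_F F Q) = F Q Q"
  by (simp add: Aut_F_def)

lemma Aut_F_mult: "\<lbrakk>\<phi> \<in> F Q Q; \<psi> \<in> F Q Q\<rbrakk> \<Longrightarrow> \<phi> \<otimes>\<^bsub>Aut_F F Q\<^esub> \<psi> = compose Q \<phi> \<psi>"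
  using endo_Bij by (simp add: Aut_F_def BijGroup_def)

lemma Aut_F_one: "\<one>\<^bsub>Aut_F F Q\<^esub> = (\<lambda>x\<in>Q. x)"
  by (simp add: Aut_F_def BijGroup_def)

lemma Aut_F_inv:
  assumes \<phi>: "\<phi> \<in> F Q Q"
  shows "inv\<^bsub>Aut_F F Q\<^esub> \<phi> = (\<lambda>x\<in>Q. inv_into Q \<phi> x)"
  using group.m_inv_consistent[OF group_BijGroup F_subgroup_BijGroup \<phi>] mor_subgroup[OF \<phi>]
    inv_BijGroup[OF endo_Bij[OF \<phi>]] by (simp add: Aut_F_def)

lemma finite_F: "finite (F Q R)"
proof (cases "F Q R = {}")
  case False
  then obtain \<phi> where \<phi>: "\<phi> \<in> F Q R" by blast
  have "finite Q" "finite R"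
    using finite_subset[OF subgroup.subset finite_P] mor_subgroup[OF \<phi>] by blast+
  moreover have "F Q R \<subseteq> Q \<rightarrow>\<^sub>E R"
  proof
    fix \<psi> assume "\<psi> \<in> F Q R"
    then show "\<psi> \<in> Q \<rightarrow>\<^sub>E R"
      using mor_closed[of \<psi> Q R] mor_extensional[of \<psi> Q R] by (intro PiE_I extensional_arb)
  qed
  ultimately show ?thesis using finite_PiE[of Q "\<lambda>_. R"] finite_subset by blast
qed simp

text \<open>For strongly closed \<open>Z\<close>, the kernel of the action of Aut_F(T) on T modulo
  \<open>T \<inter> Z\<close>.\<close>

definition congruent_autos :: "'a set \<Rightarrow> 'a set \<Rightarrow> ('a \<Rightarrow> 'a) set" where
  "congruent_autos Z T = {\<theta> \<in> F T T. \<forall>x\<in>T. Z #> \<theta> x = Z #> x}"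

lemma congruent_autos_normal:
  assumes Z: "strongly_closed P F Z" and T: "subgroup T P"
  shows "congruent_autos Z T \<lhd> Aut_F F T"
proof -
  let ?A = "Aut_F F T"
  interpret A: group ?A using Aut_F_group[OF T] .
  have bij: "\<theta> ` T = T" "inj_on \<theta> T" if "\<theta> \<in> F T T" for \<theta>
    using endo_Bij[OF that] by (auto simp: Bij_def bij_betw_def)
  have F: "\<theta> \<in> F T T" if "\<theta> \<in> congruent_autos Z T" for \<theta>
    using that by (simp add: congruent_autos_def)
  have inv_cl: "inv\<^bsub>?A\<^esub> \<theta> \<in> F T T" if "\<theta> \<in> F T T" for \<theta>
    using A.inv_closed[of \<theta>] that Aut_F_carrier by metis
  have "subgroup (congruent_autos Z T) ?A"
  proof (rule A.subgroupI)
    show "congruent_autos Z T \<subseteq> carrier ?A" using F by (auto simp: Aut_F_carrier)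
    have "(\<lambda>x\<in>T. x) \<in> congruent_autos Z T"
      using inclusion[OF T T] by (simp add: congruent_autos_def)
    then show "congruent_autos Z T \<noteq> {}" by blast
    fix \<theta> assume \<theta>: "\<theta> \<in> congruent_autos Z T"
    have "Z #> inv_into T \<theta> y = Z #> y" if y: "y \<in> T" for y
    proof -
      obtain x where x: "x \<in> T" "y = \<theta> x" using bij(1)[OF F[OF \<theta>]] y by blast
      then have "inv_into T \<theta> y = x" using bij(2)[OF F[OF \<theta>]] by simp
      then show ?thesis using x \<theta> by (simp add: congruent_autos_def)
    qed
    then show "inv\<^bsub>?A\<^esub> \<theta> \<in> congruent_autos Z T"
      using inv_cl[OF F[OF \<theta>]] Aut_F_inv[OF F[OF \<theta>]] by (simp add: congruent_autos_def)
    fix \<eta> assume \<eta>: "\<eta> \<in> congruent_autos Z T"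
    have "Z #> \<theta> (\<eta> x) = Z #> x" if "x \<in> T" for x
      using \<theta> \<eta> that mor_closed[OF F[OF \<eta>] that] by (simp add: congruent_autos_def)
    then show "\<theta> \<otimes>\<^bsub>?A\<^esub> \<eta> \<in> congruent_autos Z T"
      using Aut_F_mult[OF F[OF \<theta>] F[OF \<eta>]] comp[OF F[OF \<eta>] F[OF \<theta>]]
      by (simp add: congruent_autos_def compose_def)
  qed
  moreover have "\<phi> \<otimes>\<^bsub>?A\<^esub> \<theta> \<otimes>\<^bsub>?A\<^esub> inv\<^bsub>?A\<^esub> \<phi> \<in> congruent_autos Z T"
    if \<phi>: "\<phi> \<in> F T T" and \<theta>: "\<theta> \<in> congruent_autos Z T" for \<phi> \<theta>
  proof -
    have \<phi>\<theta>: "compose T \<phi> \<theta> \<in> F T T" using comp[OF F[OF \<theta>] \<phi>] .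
    have eq: "\<phi> \<otimes>\<^bsub>?A\<^esub> \<theta> \<otimes>\<^bsub>?A\<^esub> inv\<^bsub>?A\<^esub> \<phi> = compose T (compose T \<phi> \<theta>) (inv\<^bsub>?A\<^esub> \<phi>)"
      using Aut_F_mult[OF \<phi> F[OF \<theta>]] Aut_F_mult[OF \<phi>\<theta> inv_cl[OF \<phi>]] by simp
    have "Z #> \<phi> (\<theta> (inv_into T \<phi> y)) = Z #> y" if y: "y \<in> T" for y
    proof -
      obtain x where x: "x \<in> T" "y = \<phi> x" using bij(1)[OF \<phi>] y by blast
      then have "inv_into T \<phi> y = x" using bij(2)[OF \<phi>] by simp
      \<comment> \<open>Normality rests on this: \<open>\<phi>\<close> preserves congruence modulo
        \<open>Z\<close>, so the conjugate of \<open>\<theta>\<close> fixes the coset of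
        \<open>\<phi> x\<close>.\<close>
      moreover have "Z #> \<phi> (\<theta> x) = Z #> \<phi> x"
        using mor_cong[OF Z \<phi> mor_closed[OF F[OF \<theta>] x(1)] x(1)] \<theta> x by (simp add: congruent_autos_def)
      ultimately show ?thesis using x by simp
    qed
    moreover have "inv_into T \<phi> y \<in> T" if "y \<in> T" for y
      using bij(1)[OF \<phi>] that inv_into_into by metis
    ultimately have "Z #> compose T (compose T \<phi> \<theta>) (inv\<^bsub>?A\<^esub> \<phi>) y = Z #> y" if "y \<in> T" for y
      using that by (simp add: Aut_F_inv[OF \<phi>] compose_def)
    then show ?thesis
      unfolding eq congruent_autos_def using comp[OF inv_cl[OF \<phi>] \<phi>\<theta>] by blast
  qed
  ultimately show ?thesis by (simp add: A.normal_inv_iff Aut_F_carrier)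
qed

end

section \<open>Coprime action on the central series\<close>

sublocale saturated_fusion_system \<subseteq> finite_fusion_system P F
  by unfold_locales (rule finite_carrier)

context saturated_fusion_system
begin

lemma coprime_pow_eq_one:
  assumes "t \<in> carrier P" "coprime m p" "t [^] m = \<one>"
  shows "t = \<one>"
proof -
  obtain n where n: "order P = p ^ n" using p_group by blast
  have "ord t dvd m" using assms pow_eq_id by blast
  moreover have "ord t dvd p ^ n" using ord_dvd_group_order[OF assms(1)] n by simp
  moreover have "coprime m (p ^ n)" using assms(2) by simp
  ultimately have "ord t = 1" using coprime_common_divisor[of m "p ^ n" "ord t"] by simp
  then show ?thesis using assms(1) ord_eq_1 by simp
qed

text \<open>Write t for the quotient of \<open>\<theta> x\<close> by \<open>x\<close>. If
  \<open>\<theta>\<close> fixes t, its k-th iterate sends \<open>x\<close> to t^k x, so t^m = 1;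
  since t lies in a \<open>p\<close>-group and \<open>m\<close> is prime to \<open>p\<close>, t is
  trivial.\<close>

lemma endo_fix_step:
  assumes \<theta>: "\<theta> \<in> F T T" and m: "coprime m p" "\<And>y. y \<in> T \<Longrightarrow> (\<theta> ^^ m) y = y"
    and x: "x \<in> T" and fix_t: "\<theta> (\<theta> x \<otimes> inv x) = \<theta> x \<otimes> inv x"
  shows "\<theta> x = x"
proof -
  let ?t = "\<theta> x \<otimes> inv x"
  have T: "subgroup T P" using mor_subgroup \<theta> by blast
  have t: "?t \<in> T" "?t \<in> carrier P" and xc: "x \<in> carrier P" "\<theta> x \<in> carrier P"
    using x mor_closed[OF \<theta> x] T by (auto simp: subgroup.m_closed subgroup.m_inv_closed subgroup.mem_carrier)
  have tx: "\<theta> x = ?t \<otimes> x" using xc by (simp add: m_assoc)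
  have tk: "?t [^] k \<in> T \<and> \<theta> (?t [^] k) = ?t [^] k" for k :: nat
  proof (induction k)
    case 0
    then show ?case using T mor_one[OF \<theta>] by (simp add: subgroup.one_closed)
  next
    case (Suc k)
    then show ?case using mor_hom[OF \<theta>, of "?t [^] k" ?t] t T fix_t by (simp add: subgroup.m_closed)
  qed
  have "(\<theta> ^^ k) x = ?t [^] k \<otimes> x" for k
  proof (induction k)
    case 0
    then show ?case using xc by simp
  next
    case (Suc k)
    then have "(\<theta> ^^ Suc k) x = ?t [^] k \<otimes> \<theta> x"
      using mor_hom[OF \<theta>, of "?t [^] k" x] x tk[of k] by simp
    also have "\<dots> = ?t [^] k \<otimes> (?t \<otimes> x)" using tx by simp
    finally show ?case using t xc by (simp add: m_assoc del: funpow.simps)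
  qed
  then have "?t [^] m \<otimes> x = x" using m(2)[OF x] by metis
  then have "?t [^] m = \<one>" using t xc by simp
  then have "?t = \<one>" using coprime_pow_eq_one[OF t(2) m(1)] by simp
  then show ?thesis using tx xc by simp
qed

text \<open>Coprime action on the chain of the intersections of \<open>T\<close> with the terms of
  the series, topped by \<open>T\<close>: each step uses that \<open>\<theta>\<close> already fixes
  the member below.\<close>

lemma congruent_auto_trivial:
  assumes \<theta>: "\<theta> \<in> congruent_autos (centre_series P F n) T"
    and m: "coprime m p" "\<And>y. y \<in> T \<Longrightarrow> (\<theta> ^^ m) y = y" and x: "x \<in> T"
  shows "\<theta> x = x"
proof -
  have F: "\<theta> \<in> F T T" using \<theta> by (simp add: congruent_autos_def)
  have T: "subgroup T P" using F mor_subgroup by blast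
  have tT: "\<theta> y \<otimes> inv y \<in> T" if "y \<in> T" for y
    using that mor_closed[OF F that] T by (simp add: subgroup.m_closed subgroup.m_inv_closed)
  have fixed: "\<theta> y = y" if "y \<in> T" "y \<in> centre_series P F i" for i y
    using that
  proof (induction i arbitrary: y)
    case 0
    then show ?case using mor_centre[OF F] by simp
  next
    case (Suc i)
    show ?case
      using endo_fix_step[OF F m Suc.prems(1) Suc.IH[OF tT[OF Suc.prems(1)] mor_centre_series[OF F Suc.prems]]] .
  qed
  interpret Z: normal "centre_series P F n" P
    using centre_series_closed_liftable strongly_closed_normal by blast
  have "centre_series P F n #> \<theta> x = centre_series P F n #> x"
    using \<theta> x by (simp add: congruent_autos_def)
  \<comment> \<open>The top step of the chain, from the last term up to \<open>T\<close>; here the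
    congruence hypothesis replaces the triviality on a central factor.\<close>
  then have "\<theta> x \<otimes> inv x \<in> centre_series P F n"
    using Z.r_coset_eq_iff mor_carrier[OF F x] mor_dom_carrier[OF F x] by simp
  then show ?thesis using endo_fix_step[OF F m x fixed[OF tT[OF x]]] by simp
qed

text \<open>By coprime action this normal subgroup of \<open>Aut_F F T\<close> is a
  \<open>p\<close>-group, hence contained in the Sylow subgroup \<open>Aut_P P T\<close>.\<close>

lemma congruent_autos_subset_Aut_P:
  assumes T: "subgroup T P" "fully_normalized P F T"
  shows "congruent_autos (centre_series P F n) T \<subseteq> Aut_P P T"
proof -
  let ?K = "congruent_autos (centre_series P F n) T" and ?A = "Aut_F F T"
  interpret A: group ?A using Aut_F_group[OF T(1)] .
  have K: "?K \<lhd> ?A" using congruent_autos_normal centre_series_closed_liftable T(1) by blast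
  have fin: "finite (carrier ?A)" using finite_F by (simp add: Aut_F_carrier)
  have KF: "?K \<subseteq> F T T" by (auto simp: congruent_autos_def)
  interpret K: group "?A\<lparr>carrier := ?K\<rparr>"
    using A.subgroup_imp_group[OF normal_imp_subgroup[OF K]] .
  have "\<exists>k::nat. order (?A\<lparr>carrier := ?K\<rparr>) = p ^ k"
  proof (rule K.p_groupI[OF prime_p])
    show "finite (carrier (?A\<lparr>carrier := ?K\<rparr>))" using finite_subset[OF KF finite_F] by simp
    fix \<theta> m assume \<theta>: "\<theta> \<in> carrier (?A\<lparr>carrier := ?K\<rparr>)" and m: "coprime m p"
      and pow: "\<theta> [^]\<^bsub>?A\<lparr>carrier := ?K\<rparr>\<^esub> m = \<one>\<^bsub>?A\<lparr>carrier := ?K\<rparr>\<^esub>"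
    have \<theta>K: "\<theta> \<in> ?K" and \<theta>F: "\<theta> \<in> F T T" using \<theta> KF by auto
    have "\<theta> [^]\<^bsub>BijGroup T\<^esub> m = (\<lambda>x\<in>T. x)"
      using pow by (simp add: Aut_F_def nat_pow_def BijGroup_def)
    then have "(\<theta> ^^ m) y = y" if "y \<in> T" for y
      using BijGroup_pow[OF endo_Bij[OF \<theta>F] that, of m] that by simp
    then have "\<theta> x = x" if "x \<in> T" for x using congruent_auto_trivial[OF \<theta>K m] that by blast
    then have "\<theta> = (\<lambda>x\<in>T. x)"
      using mor_extensional[OF \<theta>F] by (auto simp: extensional_def restrict_def)
    then show "\<theta> = \<one>\<^bsub>?A\<lparr>carrier := ?K\<rparr>\<^esub>" by (simp add: Aut_F_one)
  qed
  then obtain k :: nat where "card ?K = p ^ k" by (auto simp: order_def)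
  then show ?thesis
    using A.normal_p_subgroup_in_sylow[OF prime_p fin K] fully_normalized_imp[OF T] by blast
qed

section \<open>Fully normalized images and extension domains\<close>

text \<open>Choose \<open>\<alpha>\<close> with the largest possible normalizer of the image.
  Conjugates of that image are again images of \<open>R\<close> under morphisms.\<close>

lemma exists_fully_normalized:
  assumes R: "subgroup R P"
  shows "\<exists>\<alpha>\<in>F R (carrier P). fully_normalized P F (\<alpha> ` R)"
proof -
  have "card (normalizer P S) \<le> card (carrier P)" for S
    using card_mono[OF finite_P normalizer_subset] .
  moreover have "(\<lambda>x\<in>R. x) \<in> F R (carrier P)"
    using inclusion[OF R subgroup_self] R by (simp add: subgroup.subset)
  ultimately have "\<exists>\<alpha>. \<alpha> \<in> F R (carrier P) \<and> (\<forall>\<beta>. \<beta> \<in> F R (carrier P) \<longrightarrow>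
      card (normalizer P (\<beta> ` R)) \<le> card (normalizer P (\<alpha> ` R)))"
    by (intro ex_has_greatest_nat[where b = "Suc (card (carrier P))"]) (auto simp: less_Suc_eq_le)
  then obtain \<alpha> where \<alpha>: "\<alpha> \<in> F R (carrier P)"
    "\<And>\<beta>. \<beta> \<in> F R (carrier P) \<Longrightarrow> card (normalizer P (\<beta> ` R)) \<le> card (normalizer P (\<alpha> ` R))"
    by blast
  have "card (normalizer P S) \<le> card (normalizer P (\<alpha> ` R))" if conj: "F_conjugate F (\<alpha> ` R) S" for S
  proof -
    obtain \<beta> where \<beta>: "\<beta> \<in> F (\<alpha> ` R) S" "\<beta> ` \<alpha> ` R = S"
      using conj by (auto simp: F_conjugate_def)
    have "compose R \<beta> \<alpha> \<in> F R S" using comp[OF image[OF \<alpha>(1)] \<beta>(1)] .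
    moreover have im: "compose R \<beta> \<alpha> ` R = S" using \<beta>(2) by (simp add: compose_def image_image)
    ultimately have "compose R \<beta> \<alpha> \<in> F R (carrier P)"
      using change_codomain[OF _ subgroup_self] mor_subgroup[OF \<beta>(1)] subgroup.subset by metis
    then show ?thesis using \<alpha>(2) im by metis
  qed
  then show ?thesis using \<alpha>(1) by (auto simp: fully_normalized_def)
qed

text \<open>For \<open>u\<close> in \<open>R\<close> the required element of the normalizer of the
  image is \<open>\<alpha> u\<close>.\<close>

lemma subset_extension_domain:
  assumes \<alpha>: "\<alpha> \<in> F R (carrier P)"
  shows "R \<subseteq> extension_domain P R \<alpha>"
proof
  fix u assume u: "u \<in> R"
  have R: "subgroup R P" and T: "subgroup (\<alpha> ` R) P" using mor_subgroup[OF \<alpha>] mor_subgroup[OF image[OF \<alpha>]] by auto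
  have fin: "finite R" "finite (\<alpha> ` R)" using R finite_P by (auto intro: finite_subset dest: subgroup.subset)
  have norm: "g \<in> normalizer P S" if "subgroup S P" "finite S" "g \<in> S" for g S
    using that by (intro mem_normalizerI) (auto simp: subgroup.m_closed subgroup.m_inv_closed subgroup.mem_carrier)
  have "\<alpha> (conj_map P u R v) = conj_map P (\<alpha> u) (\<alpha> ` R) (\<alpha> v)" if v: "v \<in> R" for v
  proof -
    have "inv u \<in> R" "inv u \<otimes> v \<in> R" using u v R by (auto simp: subgroup.m_closed subgroup.m_inv_closed)
    then show ?thesis using u v mor_hom[OF \<alpha>] mor_inv[OF \<alpha>] by (simp add: conj_map_def)
  qed
  then show "u \<in> extension_domain P R \<alpha>"
    using norm[OF R fin(1) u] norm[OF T fin(2)] u by (auto simp: extension_domain_def)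
qed

lemma centre_series_mem_extension_domain:
  assumes \<alpha>: "\<alpha> \<in> F R (carrier P)" "fully_normalized P F (\<alpha> ` R)"
    and u: "u \<in> centre_series P F n" "\<And>r. r \<in> R \<Longrightarrow> inv u \<otimes> r \<otimes> u \<in> R"
  shows "u \<in> extension_domain P R \<alpha>"
proof -
  let ?Z = "centre_series P F n" and ?T = "\<alpha> ` R"
  have Z: "strongly_closed P F ?Z" using centre_series_closed_liftable by blast
  interpret Z: normal ?Z P using Z by (rule strongly_closed_normal)
  have R: "subgroup R P" and T: "subgroup ?T P"
    using mor_subgroup[OF \<alpha>(1)] mor_subgroup[OF image[OF \<alpha>(1)]] by auto
  have fin: "finite R" using R finite_P by (auto intro: finite_subset dest: subgroup.subset)
  have uc: "u \<in> carrier P" using u(1) by simp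
  have norm: "u \<in> normalizer P R" using mem_normalizerI[OF R fin uc u(2)] .
  let ?c = "conj_map P u R" and ?i = "restrict (inv_into R \<alpha>) ?T"
  have c: "?c \<in> F R R" using conj[OF R R uc] u(2) by (auto simp: conj_map_def)
  have i: "?i \<in> F ?T R" using inverse[OF image[OF \<alpha>(1)]] by simp
  define \<theta> where "\<theta> = compose ?T \<alpha> (compose ?T ?c ?i)"
  have \<theta>: "\<theta> \<in> F ?T ?T" unfolding \<theta>_def using comp[OF comp[OF i c] image[OF \<alpha>(1)]] .
  have val: "\<theta> (\<alpha> r) = \<alpha> (?c r)" if "r \<in> R" for r
    using that mor_inj[OF \<alpha>(1)] by (simp add: \<theta>_def compose_def)
  have "?Z #> \<theta> y = ?Z #> y" if y: "y \<in> ?T" for y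
  proof -
    obtain r where r: "r \<in> R" "y = \<alpha> r" using y by blast
    have rc: "r \<in> carrier P" using r R by (simp add: subgroup.mem_carrier)
    \<comment> \<open>This commutator is a product of the inverse of \<open>u\<close> and a
      conjugate of \<open>u\<close>, so it lies in the normal subgroup \<open>?Z\<close>.\<close>
    have "?c r \<otimes> inv r = inv u \<otimes> (r \<otimes> u \<otimes> inv r)" using r rc uc by (simp add: conj_map_def m_assoc)
    then have "?c r \<otimes> inv r \<in> ?Z" using u(1) rc Z.inv_op_closed2 by simp
    moreover have cr: "?c r \<in> R" using u(2) r by (simp add: conj_map_def)
    ultimately have "?Z #> ?c r = ?Z #> r"
      using Z.r_coset_eq_iff rc R by (simp add: subgroup.mem_carrier)
    then show ?thesis using mor_cong[OF Z \<alpha>(1) cr r(1)] val r by simp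
  qed
  then have "\<theta> \<in> Aut_P P ?T"
    using congruent_autos_subset_Aut_P[OF T \<alpha>(2), of n] \<theta> by (auto simp: congruent_autos_def)
  then obtain h where h: "h \<in> normalizer P ?T" "\<theta> = conj_map P h ?T" by (auto simp: Aut_P_def)
  then have "\<forall>r\<in>R. \<alpha> (?c r) = conj_map P h ?T (\<alpha> r)" using val by simp
  then show ?thesis using h(1) norm by (auto simp: extension_domain_def)
qed

section \<open>Extending morphisms to the hypercentre\<close>

text \<open>Take \<open>u\<close> outside \<open>R\<close> in the first term of the series not
  contained in \<open>R\<close>. Commutators of \<open>u\<close> with \<open>R\<close> lie in the
  preceding term, hence in \<open>R\<close>.\<close>

lemma exists_normalizing_element:
  assumes R: "subgroup R P" and not_sub: "\<not> centre_series P F n \<subseteq> R"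
  shows "\<exists>u\<in>centre_series P F n - R. \<forall>r\<in>R. inv u \<otimes> r \<otimes> u \<in> R"
proof -
  define i where "i = (LEAST i. \<not> centre_series P F i \<subseteq> R)"
  have least: "centre_series P F j \<subseteq> R" if "j < i" for j
    using not_less_Least[of j "\<lambda>i. \<not> centre_series P F i \<subseteq> R"] that by (simp add: i_def)
  have i: "\<not> centre_series P F i \<subseteq> R"
    using LeastI[of "\<lambda>i. \<not> centre_series P F i \<subseteq> R", OF not_sub] unfolding i_def .
  then obtain u where u: "u \<in> centre_series P F i" "u \<notin> R" by blast
  have "i \<le> n" unfolding i_def using not_sub by (rule Least_le)
  then have un: "u \<in> centre_series P F n" using u(1) centre_series_mono by blast
  have Zi: "subgroup (centre_series P F i) P"
    using centre_series_closed_liftable strongly_closed_subgroup by blast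
  have uc: "u \<in> carrier P" and iu: "inv u \<in> centre_series P F i"
    using u(1) Zi by (auto simp: subgroup.mem_carrier subgroup.m_inv_closed)
  have "inv u \<otimes> r \<otimes> u \<in> R" if r: "r \<in> R" for r
  proof -
    have rc: "r \<in> carrier P" using r R by (simp add: subgroup.mem_carrier)
    \<comment> \<open>Conjugation by \<open>r\<close> is itself a morphism on \<open>P\<close>.
      Applying it to the inverse of \<open>u\<close> produces the commutator in the order needed
      below.\<close>
    let ?c = "conj_map P r (carrier P)"
    have c: "?c \<in> F (carrier P) (carrier P)"
      using conj[OF subgroup_self subgroup_self rc] rc by (auto simp: conj_map_def)
    have iuc: "inv u \<in> carrier P" using uc by simp
    have "?c (inv u) \<otimes> inv (inv u) \<in> R"
    proof (cases i)
      case 0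
      then have "?c (inv u) = inv u" using mor_centre[OF c iuc] iu by simp
      then show ?thesis using uc R by (simp add: subgroup.one_closed)
    next
      case (Suc j)
      then have "?c (inv u) \<otimes> inv (inv u) \<in> centre_series P F j"
        using mor_centre_series[OF c iuc] iu by (simp del: centre_series.simps)
      then show ?thesis using least[of j] Suc by blast
    qed
    moreover have "?c (inv u) \<otimes> inv (inv u) = inv r \<otimes> (inv u \<otimes> r \<otimes> u)"
      using rc uc by (simp add: conj_map_def m_assoc)
    ultimately have "r \<otimes> (inv r \<otimes> (inv u \<otimes> r \<otimes> u)) \<in> R" using r R by (simp add: subgroup.m_closed)
    moreover have "r \<otimes> (inv r \<otimes> (inv u \<otimes> r \<otimes> u)) = inv u \<otimes> r \<otimes> u"
      using rc uc by (simp add: m_assoc[symmetric])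
    ultimately show ?thesis by simp
  qed
  then show ?thesis using un u(2) by blast
qed

lemma join_subgroup: "subgroup R P \<Longrightarrow> subgroup (generate P (centre_series P F n \<union> R)) P"
  using centre_series_closed_liftable strongly_closed_subgroup subgroup.subset
  by (intro generate_is_subgroup) blast

text \<open>Inductive step for a fully normalized image: saturation extends \<open>\<alpha>\<close>
  to its extension domain, which contains \<open>R\<close> and a further element \<open>u\<close> of
  the term. The induction hypothesis, applied to a larger subgroup, does the rest.\<close>

lemma extend_to_fully_normalized:
  assumes IH: "\<And>R' \<phi>. \<lbrakk>\<phi> \<in> F R' (carrier P); card R < card R'\<rbrakk> \<Longrightarrow>
      \<exists>\<psi>\<in>F (generate P (centre_series P F n \<union> R')) (carrier P). \<forall>u\<in>R'. \<psi> u = \<phi> u"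
    and \<alpha>: "\<alpha> \<in> F R (carrier P)" "fully_normalized P F (\<alpha> ` R)"
  shows "\<exists>\<psi>\<in>F (generate P (centre_series P F n \<union> R)) (carrier P). \<forall>u\<in>R. \<psi> u = \<alpha> u"
proof (cases "centre_series P F n \<subseteq> R")
  case True
  then show ?thesis using generate_subgroup mor_subgroup[OF \<alpha>(1)] \<alpha>(1) by metis
next
  case False
  let ?Z = "centre_series P F n" and ?D = "extension_domain P R \<alpha>"
  let ?J = "generate P (?Z \<union> R)"
  \<comment> \<open>Intersecting with \<open>?J\<close> ensures that joining this larger subgroup
    with the term of the series gives \<open>?J\<close> again.\<close>
  let ?R = "?D \<inter> ?J"
  have R: "subgroup R P" using mor_subgroup[OF \<alpha>(1)] by simp
  have J: "subgroup ?J P" using join_subgroup[OF R] .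
  obtain u where u: "u \<in> ?Z" "u \<notin> R" "\<And>r. r \<in> R \<Longrightarrow> inv u \<otimes> r \<otimes> u \<in> R"
    using exists_normalizing_element[OF R False] by blast
  have uD: "u \<in> ?D" using centre_series_mem_extension_domain[OF \<alpha> u(1,3)] .
  have RD: "R \<subseteq> ?D" using subset_extension_domain[OF \<alpha>(1)] .
  have RJ: "R \<subseteq> ?J" "u \<in> ?J" using u(1) by (auto intro: generate.incl)
  have "fully_centralized P F (\<alpha> ` R)"
    using fully_normalized_imp[OF _ \<alpha>(2)] mor_subgroup[OF image[OF \<alpha>(1)]] by blast
  then obtain \<beta> where \<beta>: "\<beta> \<in> F ?D (carrier P)" "\<And>v. v \<in> R \<Longrightarrow> \<beta> v = \<alpha> v"
    using extension[OF \<alpha>(1)] by blast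
  have R': "subgroup ?R P" using subgroups_Inter_pair[OF mor_subgroup(1)[OF \<beta>(1)] J] .
  have res: "restrict \<beta> ?R \<in> F ?R (carrier P)"
    using mor_carrier[OF \<beta>(1)] by (intro restriction[OF \<beta>(1) R' _ subgroup_self]) auto
  have "finite ?R" using finite_P subgroup.subset[OF R'] finite_subset by blast
  moreover have "R \<subset> ?R" using RD RJ uD u(2) by blast
  ultimately have "card R < card ?R" by (rule psubset_card_mono)
  then obtain \<gamma> where \<gamma>: "\<gamma> \<in> F (generate P (?Z \<union> ?R)) (carrier P)" "\<And>v. v \<in> ?R \<Longrightarrow> \<gamma> v = restrict \<beta> ?R v"
    using IH[OF res] by blast
  have "generate P (?Z \<union> ?R) = ?J"
  proof
    show "generate P (?Z \<union> ?R) \<subseteq> ?J"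
      using J by (intro generate_subgroup_incl) (auto intro: generate.incl)
    show "?J \<subseteq> generate P (?Z \<union> ?R)" using RD RJ by (intro mono_generate) blast
  qed
  then have "\<gamma> \<in> F ?J (carrier P)" using \<gamma>(1) by simp
  moreover have "\<gamma> v = \<alpha> v" if "v \<in> R" for v using that \<gamma>(2)[of v] \<beta>(2)[of v] RD RJ by auto
  ultimately show ?thesis by blast
qed

text \<open>A morphism defined on a term of the series permutes it, by strong closure and
  finiteness. Consequently two extensions whose images of the original subgroups agree have the same
  image on the joins.\<close>

lemma image_join:
  assumes \<phi>: "\<phi> \<in> F (generate P (centre_series P F n \<union> R)) (carrier P)" and R: "subgroup R P"
  shows "\<phi> ` generate P (centre_series P F n \<union> R) = generate P (centre_series P F n \<union> \<phi> ` R)"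
proof
  let ?Z = "centre_series P F n"
  let ?J = "generate P (?Z \<union> R)"
  have Z: "strongly_closed P F ?Z" using centre_series_closed_liftable by blast
  have Zc: "?Z \<subseteq> carrier P" "finite ?Z"
    using subgroup.subset[OF strongly_closed_subgroup[OF Z]] finite_P finite_subset by auto
  have sub: "?Z \<subseteq> ?J" "R \<subseteq> ?J" by (auto intro: generate.incl)
  have "\<phi> ` ?Z \<subseteq> ?Z" using strongly_closed_mem[OF Z \<phi>] sub by blast
  then have im: "\<phi> ` ?Z = ?Z" using mor_inj[OF \<phi>] sub Zc by (meson endo_inj_surj inj_on_subset)
  have "\<phi> ` R \<subseteq> carrier P" using mor_carrier[OF \<phi>] sub by blast
  then have J': "subgroup (generate P (?Z \<union> \<phi> ` R)) P" using Zc by (intro generate_is_subgroup) blast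
  have "\<phi> ` (?Z \<union> R) \<subseteq> generate P (?Z \<union> \<phi> ` R)"
    unfolding image_Un im by (auto intro: generate.incl)
  then show "\<phi> ` ?J \<subseteq> generate P (?Z \<union> \<phi> ` R)"
    using mor_generate_subset[OF \<phi> _ J'] sub by simp
  have "?Z \<union> \<phi> ` R \<subseteq> \<phi> ` ?J" using im sub by blast
  then show "generate P (?Z \<union> \<phi> ` R) \<subseteq> \<phi> ` ?J"
    using generate_subgroup_incl mor_subgroup[OF image[OF \<phi>]] by blast
qed

text \<open>Downward induction on the order of \<open>R\<close>. Choose \<open>\<alpha>\<close> from
  the image of \<open>\<phi>\<close> to a fully normalized subgroup; both \<open>\<alpha>\<close>
  and \<open>\<phi>\<close> followed by \<open>\<alpha>\<close> have fully normalized image and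
  extend. The extension of the composite followed by the inverse of the extension of
  \<open>\<alpha>\<close> extends \<open>\<phi>\<close>.\<close>

lemma extend_to_join:
  assumes "\<phi> \<in> F R (carrier P)"
  shows "\<exists>\<psi>\<in>F (generate P (centre_series P F n \<union> R)) (carrier P). \<forall>u\<in>R. \<psi> u = \<phi> u"
  using assms
proof (induction "card (carrier P) - card R" arbitrary: R \<phi> rule: less_induct)
  case less
  let ?J = "\<lambda>R. generate P (centre_series P F n \<union> R)" and ?S = "\<phi> ` R"
  note \<phi> = less.prems
  have R: "subgroup R P" and S: "subgroup ?S P"
    using mor_subgroup[OF \<phi>] mor_subgroup[OF image[OF \<phi>]] by auto
  have card: "card ?S = card R" using mor_inj[OF \<phi>] by (rule card_image)
  have IH: "\<exists>\<psi>\<in>F (?J R') (carrier P). \<forall>u\<in>R'. \<psi> u = \<eta> u"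
    if \<eta>: "\<eta> \<in> F R' (carrier P)" and "card R < card R'" for R' \<eta>
  proof (rule less.hyps[OF _ \<eta>])
    have "card R' \<le> card (carrier P)"
      using mor_subgroup[OF \<eta>] finite_P by (simp add: card_mono subgroup.subset)
    then show "card (carrier P) - card R' < card (carrier P) - card R" using that(2) by simp
  qed
  obtain \<alpha> where \<alpha>: "\<alpha> \<in> F ?S (carrier P)" "fully_normalized P F (\<alpha> ` ?S)"
    using exists_fully_normalized[OF S] by blast
  define \<beta> where "\<beta> = compose R \<alpha> \<phi>"
  have \<beta>: "\<beta> \<in> F R (carrier P)" unfolding \<beta>_def using comp[OF image[OF \<phi>] \<alpha>(1)] .
  have \<beta>_val: "\<beta> u = \<alpha> (\<phi> u)" if "u \<in> R" for u using that by (simp add: \<beta>_def compose_def)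
  then have \<beta>_im: "\<beta> ` R = \<alpha> ` ?S" by (auto simp: image_image)
  \<comment> \<open>The induction hypothesis serves for \<open>?S\<close> as well, which has the
    same order as \<open>R\<close>.\<close>
  obtain \<alpha>' where \<alpha>': "\<alpha>' \<in> F (?J ?S) (carrier P)" "\<And>v. v \<in> ?S \<Longrightarrow> \<alpha>' v = \<alpha> v"
    using extend_to_fully_normalized[OF _ \<alpha>] IH card by metis
  have "\<exists>\<psi>\<in>F (?J R) (carrier P). \<forall>u\<in>R. \<psi> u = \<beta> u"
    using extend_to_fully_normalized[OF IH \<beta>] \<beta>_im \<alpha>(2) by simp
  then obtain \<beta>' where \<beta>': "\<beta>' \<in> F (?J R) (carrier P)" "\<And>v. v \<in> R \<Longrightarrow> \<beta>' v = \<beta> v"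
    by blast
  have "\<alpha>' ` ?S = \<beta>' ` R" using \<alpha>'(2) \<beta>'(2) \<beta>_val by (auto simp: image_image)
  then have im: "\<alpha>' ` ?J ?S = \<beta>' ` ?J R" using image_join[OF \<alpha>'(1) S] image_join[OF \<beta>'(1) R] by simp
  let ?i = "restrict (inv_into (?J ?S) \<alpha>') (\<alpha>' ` ?J ?S)"
  have i: "?i \<in> F (\<beta>' ` ?J R) (?J ?S)" using inverse[OF image[OF \<alpha>'(1)] refl] im by simp
  have "compose (?J R) ?i \<beta>' \<in> F (?J R) (?J ?S)" using comp[OF image[OF \<beta>'(1)] i] .
  then have "compose (?J R) ?i \<beta>' \<in> F (?J R) (carrier P)"
    using change_codomain[OF _ subgroup_self] mor_carrier by blast
  moreover have "compose (?J R) ?i \<beta>' u = \<phi> u" if u: "u \<in> R" for u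
  proof -
    have uJ: "u \<in> ?J R" "\<phi> u \<in> ?J ?S" using u by (auto intro: generate.incl)
    have eq: "\<beta>' u = \<alpha>' (\<phi> u)" using u \<alpha>'(2) \<beta>'(2) \<beta>_val by simp
    then have "?i (\<beta>' u) = \<phi> u" using mor_inj[OF \<alpha>'(1)] uJ by simp
    then show ?thesis using uJ by (simp add: compose_def)
  qed
  ultimately show ?case by blast
qed

text \<open>A term of the series is normal in \<open>P\<close>, hence fully normalized, and its
  automorphisms are trivially congruent to the identity modulo the term itself.\<close>

lemma endo_centre_series_conj:
  assumes "\<theta> \<in> F (centre_series P F n) (centre_series P F n)"
  shows "\<exists>g\<in>carrier P. \<theta> = conj_map P g (centre_series P F n)"
proof -
  let ?Z = "centre_series P F n"
  have Z: "strongly_closed P F ?Z" using centre_series_closed_liftable by blast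
  interpret Z: normal ?Z P using Z by (rule strongly_closed_normal)
  have fin: "finite ?Z" using finite_P Z.subset finite_subset by blast
  have "fully_normalized P F ?Z"
    using card_mono[OF finite_P normalizer_subset] Z.normalizer_eq[OF fin]
    by (simp add: fully_normalized_def)
  moreover have "\<theta> \<in> congruent_autos ?Z ?Z"
    using assms mor_closed[OF assms] by (auto simp: congruent_autos_def Z.rcos_const)
  ultimately have "\<theta> \<in> Aut_P P ?Z"
    using congruent_autos_subset_Aut_P[OF Z.is_subgroup, of n] by blast
  then show ?thesis using normalizer_subset by (auto simp: Aut_P_def)
qed

section \<open>The two implications\<close>

text \<open>A morphism extends to the join of its domain with the hypercentre and acts on the
  hypercentre as conjugation by some \<open>g\<close> in \<open>P\<close>. Restricting this
  extension to the product of \<open>N\<close> with the domain gives the required one.\<close>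

lemma NC_system_eq_if_subset_hypercentre:
  assumes N: "N \<lhd> P" and sub: "N \<subseteq> hypercentre P F"
  shows "F = NC_system P F N"
proof -
  interpret N: normal N P by (rule N)
  obtain n where n: "N \<subseteq> centre_series P F n" using sub hypercentre_is_term by metis
  let ?Z = "centre_series P F n"
  have Z: "strongly_closed P F ?Z" using centre_series_closed_liftable by blast
  have NZ: "normalizer P N = carrier P"
    using N.normalizer_eq N.subset finite_P finite_subset by blast
  have "\<phi> \<in> NC_system P F N R S" if \<phi>: "\<phi> \<in> F R S" for \<phi> R S
  proof -
    have R: "subgroup R P" and S: "subgroup S P" using mor_subgroup[OF \<phi>] by auto
    have "second_isomorphism_grp N P R" "second_isomorphism_grp N P S"
      using N R S by (auto simp: second_isomorphism_grp_def second_isomorphism_grp_axioms_def)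
    then have NR: "subgroup (N <#> R) P" and NS: "subgroup (N <#> S) P"
      and R_sub: "R \<subseteq> N <#> R" and N_sub: "N \<subseteq> N <#> R"
      using second_isomorphism_grp.normal_set_mult_subgroup second_isomorphism_grp.S_contained_in_set_mult
        second_isomorphism_grp.H_contained_in_set_mult by metis+
    let ?J = "generate P (?Z \<union> R)"
    have J: "subgroup ?J P" using join_subgroup[OF R] .
    have "\<phi> \<in> F R (carrier P)"
      using change_codomain[OF \<phi> subgroup_self] mor_carrier[OF \<phi>] by blast
    then obtain \<psi> where \<psi>: "\<psi> \<in> F ?J (carrier P)" "\<And>u. u \<in> R \<Longrightarrow> \<psi> u = \<phi> u"
      using extend_to_join by blast
    have ZJ: "?Z \<subseteq> ?J" "R \<subseteq> ?J" by (auto intro: generate.incl)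
    have "restrict \<psi> ?Z \<in> F ?Z ?Z"
      using strongly_closed_mem[OF Z \<psi>(1)] ZJ strongly_closed_subgroup[OF Z]
      by (intro restriction[OF \<psi>(1)]) auto
    then obtain g where g: "g \<in> carrier P" "restrict \<psi> ?Z = conj_map P g ?Z"
      using endo_centre_series_conj by blast
    have \<psi>N: "\<psi> x = conj_map P g N x" if "x \<in> N" for x
    proof -
      have "\<psi> x = conj_map P g ?Z x" using g(2)[symmetric] that n by auto
      then show ?thesis using that n by (auto simp: conj_map_def)
    qed
    have NRJ: "N <#> R \<subseteq> ?J"
      using n ZJ J by (auto simp: set_mult_def subset_iff subgroup.m_closed)
    \<comment> \<open>The codomain is right because \<open>\<psi>\<close> acts on the normal
      subgroup \<open>N\<close> as conjugation by \<open>g\<close>.\<close>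
    have "\<psi> ` (N <#> R) \<subseteq> N <#> S"
    proof
      fix y assume "y \<in> \<psi> ` (N <#> R)"
      then obtain x r where x: "x \<in> N" "r \<in> R" "y = \<psi> (x \<otimes> r)" by (auto simp: set_mult_def)
      then have "y = \<psi> x \<otimes> \<phi> r" using mor_hom[OF \<psi>(1)] \<psi>(2) n ZJ by (simp add: subset_iff)
      moreover have "\<psi> x \<in> N" using \<psi>N x(1) g(1) N.inv_op_closed1 by (simp add: conj_map_def)
      ultimately show "y \<in> N <#> S" using mor_closed[OF \<phi> x(2)] by (auto simp: set_mult_def)
    qed
    then have "restrict \<psi> (N <#> R) \<in> F (N <#> R) (N <#> S)"
      using restriction[OF \<psi>(1) NR NRJ NS] by blast
    moreover have "\<forall>u\<in>R. restrict \<psi> (N <#> R) u = \<phi> u" using \<psi>(2) R_sub by auto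
    moreover have "\<forall>u\<in>N. restrict \<psi> (N <#> R) u = conj_map P g N u" using \<psi>N N_sub by auto
    ultimately show ?thesis
      unfolding NC_system_def NZ
      using \<phi> g(1) subgroup.subset[OF R] subgroup.subset[OF S] by blast
  qed
  moreover have "NC_system P F N R S \<subseteq> F R S" for R S by (auto simp: NC_system_def)
  ultimately show ?thesis by (intro ext subset_antisym) blast+
qed

text \<open>Some \<open>x\<close> in \<open>N\<close> outside the hypercentre is central in
  \<open>P\<close> modulo it. The extensions provided by the hypothesis act on \<open>x\<close> as
  conjugation by elements of \<open>P\<close>, so they fix it modulo the hypercentre; then
  \<open>x\<close> belongs to the next term, although the series has stopped.\<close>

lemma subset_hypercentre_if_NC_system_eq:
  assumes N: "N \<lhd> P" and eq: "F = NC_system P F N"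
  shows "N \<subseteq> hypercentre P F"
proof (rule ccontr)
  assume not_sub: "\<not> N \<subseteq> hypercentre P F"
  interpret N: normal N P by (rule N)
  obtain n where hyp: "hypercentre P F = centre_series P F n"
    and top: "centre_series P F (Suc n) = centre_series P F n" by (rule hypercentre_is_term)
  let ?Z = "centre_series P F n"
  have Z: "strongly_closed P F ?Z" using centre_series_closed_liftable by blast
  interpret Z: normal ?Z P using Z by (rule strongly_closed_normal)
  let ?Q = "P Mod ?Z"
  interpret Q: group ?Q by (rule Z.factorgroup_is_group)
  obtain m where m: "order P = p ^ m" using p_group by blast
  have "order ?Q dvd p ^ m"
    using lagrange[OF Z.is_subgroup] m by (metis FactGroup_def dvd_triv_left order_def partial_object.select_convs(1))
  then obtain k where k: "order ?Q = p ^ k" using prime_p divides_primepow_nat by blast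
  let ?N = "(\<lambda>x. ?Z #> x) ` N"
  have hom: "(\<lambda>x. ?Z #> x) \<in> hom P ?Q" by (rule Z.r_coset_hom_Mod)
  have normal_N: "?N \<lhd> ?Q"
    using Q.is_group hom carrier_FactGroup[of P ?Z]
    by (intro N.surj_hom_normal_subgroup) (auto simp: group_hom_def group_hom_axioms_def)
  have nontrivial_N: "?N \<noteq> {\<one>\<^bsub>?Q\<^esub>}"
  proof
    assume "?N = {\<one>\<^bsub>?Q\<^esub>}"
    then have "?Z #> x = ?Z" if "x \<in> N" for x using that by auto
    then have "N \<subseteq> ?Z" using N.subset rcos_self[OF _ Z.is_subgroup] by blast
    then show False using not_sub hyp by simp
  qed
  obtain C where C: "C \<in> ?N" "C \<noteq> \<one>\<^bsub>?Q\<^esub>"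
    "\<And>B. B \<in> carrier ?Q \<Longrightarrow> B \<otimes>\<^bsub>?Q\<^esub> C = C \<otimes>\<^bsub>?Q\<^esub> B"
    using Q.normal_subgroup_meets_centre[OF prime_p k normal_N nontrivial_N] by blast
  then obtain x where x: "x \<in> N" "C = ?Z #> x" by blast
  have xc: "x \<in> carrier P" using x by simp
  have comm: "?Z #> (inv g \<otimes> x \<otimes> g) = ?Z #> x" if g: "g \<in> carrier P" for g
  proof -
    have "?Z #> g \<in> carrier ?Q" using g by (simp add: carrier_FactGroup)
    then have "(?Z #> g) <#> (?Z #> x) = (?Z #> x) <#> (?Z #> g)" using C(3) x(2) by simp
    then have "?Z #> (x \<otimes> g) = ?Z #> (g \<otimes> x)"
      using Z.rcos_sum[OF g xc] Z.rcos_sum[OF xc g] by simp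
    then have "?Z #> (inv g \<otimes> (x \<otimes> g)) = ?Z #> (inv g \<otimes> (g \<otimes> x))"
      using Z.rcos_sum[of "inv g" "x \<otimes> g"] Z.rcos_sum[of "inv g" "g \<otimes> x"] g xc by simp
    then show ?thesis using g xc by (simp add: m_assoc[symmetric])
  qed
  have "x \<in> relative_centre P F ?Z"
    unfolding relative_centre_def
  proof (intro CollectI conjI allI ballI impI xc)
    fix Q R \<phi> assume \<phi>: "\<phi> \<in> F Q R" and ZQ: "?Z \<subseteq> Q" "?Z \<subseteq> R"
    have Q: "subgroup Q P" and R: "subgroup R P" using mor_subgroup[OF \<phi>] by auto
    have "\<phi> \<in> NC_system P F N Q R" using \<phi> eq by metis
    then obtain \<psi> g where \<psi>: "\<psi> \<in> F (N <#> Q) (N <#> R)" "\<And>u. u \<in> Q \<Longrightarrow> \<psi> u = \<phi> u"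
      and g: "g \<in> normalizer P N" "\<And>u. u \<in> N \<Longrightarrow> \<psi> u = conj_map P g N u"
      unfolding NC_system_def by blast
    have gc: "g \<in> carrier P" using g(1) normalizer_subset by blast
    have sub: "subgroup (generate P (insert x Q)) P" "subgroup (generate P (insert x R)) P"
      using xc subgroup.subset[OF Q] subgroup.subset[OF R] by (auto intro!: generate_is_subgroup)
    have "second_isomorphism_grp N P Q"
      using N Q by (simp add: second_isomorphism_grp_def second_isomorphism_grp_axioms_def)
    then have NQ: "insert x Q \<subseteq> N <#> Q"
      using x(1) second_isomorphism_grp.S_contained_in_set_mult[of N P Q]
        second_isomorphism_grp.H_contained_in_set_mult[of N P Q] by blast
    have \<psi>x: "?Z #> \<psi> x = ?Z #> x" using g(2)[OF x(1)] comm[OF gc] x(1) by (simp add: conj_map_def)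
    have \<psi>xc: "\<psi> x \<in> carrier P" using mor_carrier[OF \<psi>(1)] NQ by blast
    \<comment> \<open>The extension is only known to map into the product of \<open>N\<close> and
      \<open>R\<close>. As \<open>R\<close> contains \<open>?Z\<close>, this congruence puts
      \<open>\<psi> x\<close> into the smaller codomain generated by \<open>x\<close> and
      \<open>R\<close>.\<close>
    then have "\<psi> x \<otimes> inv x \<in> ?Z" using \<psi>x Z.r_coset_eq_iff xc by simp
    then have "\<psi> x \<otimes> inv x \<in> generate P (insert x R)" "x \<in> generate P (insert x R)"
      using ZQ by (auto intro: generate.incl)
    then have "\<psi> x \<otimes> inv x \<otimes> x \<in> generate P (insert x R)" using sub(2) subgroup.m_closed by metis
    then have "\<psi> x \<in> generate P (insert x R)" using \<psi>xc xc by (simp add: m_assoc)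
    then have "\<psi> ` insert x Q \<subseteq> generate P (insert x R)"
      using \<psi>(2) mor_closed[OF \<phi>] by (auto intro: generate.incl)
    then have "\<psi> ` generate P (insert x Q) \<subseteq> generate P (insert x R)"
      using mor_generate_subset[OF \<psi>(1) NQ sub(2)] by blast
    then have "restrict \<psi> (generate P (insert x Q)) \<in> F (generate P (insert x Q)) (generate P (insert x R))"
      using restriction[OF \<psi>(1) sub(1) _ sub(2)]
        generate_subgroup_incl[OF NQ mor_subgroup(1)[OF \<psi>(1)]] by blast
    then show "\<exists>\<psi>\<in>F (generate P (insert x Q)) (generate P (insert x R)).
       (\<forall>u\<in>Q. ?Z #> \<psi> u = ?Z #> \<phi> u) \<and> ?Z #> \<psi> x = ?Z #> x"
      using \<psi>(2) \<psi>x by (intro bexI) (auto simp: generate.incl)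
  qed
  then have "x \<in> ?Z" using top centre_series_closed_liftable(2) by blast
  then show False using C(2) x(2) by (simp add: Z.rcos_const)
qed

end

theorem theoremE:
  fixes p :: nat and P :: "('a, 'b) monoid_scheme" and F :: "'a hom_sets" and N :: "'a set"
  assumes "Factorial_Ring.prime p"
    and "saturated_fusion_system p P F"
    and "N \<lhd> P"
  shows "F = NC_system P F N \<longleftrightarrow> N \<subseteq> hypercentre P F"
  using saturated_fusion_system.NC_system_eq_if_subset_hypercentre[OF assms(2,3)]
    saturated_fusion_system.subset_hypercentre_if_NC_system_eq[OF assms(2,3)] by blast

end
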